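(* Let $G$ be a finite group and let $p$ be a fixed prime divisor of $|G|$. Suppose that every maximal subgroup of $G$ is nilpotent, or normal in $G$, or has order not divisible by $p$. Then $G$ is solvable. *)

theory Defs
  imports "HOL-Algebra.Solvable_Groups" "HOL-Computational_Algebra.Primes"
begin

primrec lower_central :: "('a, 'b) monoid_scheme \<Rightarrow> nat \<Rightarrow> 'a set" where
  "lower_central G 0 = carrier G"
| "lower_central G (Suc n) =
     generate G {x \<otimes>\<^bsub>G\<^esub> y \<otimes>\<^bsub>G\<^esub> inv\<^bsub>G\<^esub> x \<otimes>\<^bsub>G\<^esub> inv\<^bsub>G\<^esub> y | x y.
                 x \<in> lower_central G n \<and> y \<in> carrier G}"

definition nilpotent_group :: "('a, 'b) monoid_scheme \<Rightarrow> bool" where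
  "nilpotent_group G \<longleftrightarrow> group G \<and> (\<exists>n. lower_central G n = {\<one>\<^bsub>G\<^esub>})"

definition maximal_subgroup :: "'a set \<Rightarrow> ('a, 'b) monoid_scheme \<Rightarrow> bool" where
  "maximal_subgroup H G \<longleftrightarrow> subgroup H G \<and> H \<noteq> carrier G \<and>
     (\<forall>K. subgroup K G \<and> H \<subseteq> K \<longrightarrow> K = H \<or> K = carrier G)"

end

theory Submission
  imports Defs "HOL-Algebra.Sylow" "HOL-Algebra.Zassenhaus" "HOL-Algebra.Elementary_Groups"
    "HOL-Algebra.Weak_Morphisms"
begin

text \<open>
  Take a counterexample \<open>G\<close> of least order. Factoring out a nontrivial normal \<open>p\<close>-subgroup \<open>R\<close>
  preserves the hypothesis, even with any prime divisor of \<open>|G / R|\<close> in place of \<open>p\<close>; so \<open>G\<close> has no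
  such \<open>R\<close>. Let \<open>L\<close> be a minimal normal subgroup. A proper subgroup \<open>X\<close> with \<open>L X = G\<close>,
  \<open>X \<inter> L \<noteq> 1\<close> and \<open>p\<close> dividing \<open>|X|\<close> lies in a maximal subgroup, which cannot be normal, hence is
  nilpotent, hence is the normalizer of a Sylow \<open>p\<close>-subgroup of \<open>G\<close>.

  If \<open>p\<close> divides \<open>|G / L|\<close>, Frattini's argument applies this to the normalizer in \<open>G\<close> of each Sylow
  subgroup of \<open>L\<close>, unless \<open>L\<close> is a \<open>q\<close>-group (and then \<open>G / L\<close> solvable makes \<open>G\<close> solvable). All
  these subgroups lie in conjugates of one group \<open>N(P)\<close>, so that \<open>L \<subseteq> N(P)\<close>, a contradiction.

  If \<open>p\<close> does not divide \<open>|G / L|\<close>, a Sylow subgroup \<open>P\<close> of \<open>G\<close> lies in \<open>L\<close>, and \<open>M = N(P)\<close> is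
  nilpotent with \<open>M = P C(P)\<close>. Hence \<open>G = L C(P)\<close>, and the normalizer of every nontrivial subgroup
  of \<open>P\<close> lies in the normalizer of a Sylow subgroup. It follows that distinct Sylow \<open>p\<close>-subgroups
  intersect trivially, so that the transfer \<open>G \<rightarrow> P / P'\<close> sends \<open>x \<in> P\<close> to the class of \<open>x\<close> to the
  power \<open>|M : P|\<close>. Its kernel meets \<open>L\<close> trivially, so \<open>L\<close> is abelian and \<open>P\<close> is normal: a contradiction.
\<close>

section \<open>Conjugates and normalizers\<close>

text \<open>Written as an image of a map rather than as \<open>g <# S #> inv g\<close>, so that
  membership, inclusion and cardinality are facts about images; \<open>conj_set_eq_cosets\<close>
  links it to the coset form on which \<open>normalizer\<close> rests.\<close>

definition conj_set :: "('a, 'b) monoid_scheme \<Rightarrow> 'a \<Rightarrow> 'a set \<Rightarrow> 'a set" where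
  "conj_set G g S = (\<lambda>x. g \<otimes>\<^bsub>G\<^esub> x \<otimes>\<^bsub>G\<^esub> inv\<^bsub>G\<^esub> g) ` S"

context group
begin

text \<open>Rewriting with \<open>m_assoc\<close> nests products to the right, so a cancelling pair
  is followed by a tail; these forms remove the pair there.\<close>

lemma mult_inv_cancel_left [simp]:
  "x \<in> carrier G \<Longrightarrow> y \<in> carrier G \<Longrightarrow> x \<otimes> (inv x \<otimes> y) = y"
  "x \<in> carrier G \<Longrightarrow> y \<in> carrier G \<Longrightarrow> inv x \<otimes> (x \<otimes> y) = y"
  by (simp_all add: m_assoc[symmetric])

lemma conj_set_eq_cosets: "S \<subseteq> carrier G \<Longrightarrow> g \<in> carrier G \<Longrightarrow> conj_set G g S = g <# S #> inv g"
  by (auto simp: conj_set_def l_coset_def r_coset_def)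

lemma conj_set_subset:
  "S \<subseteq> carrier G \<Longrightarrow> g \<in> carrier G \<Longrightarrow> conj_set G g S \<subseteq> carrier G"
  by (auto simp: conj_set_def)

lemma conj_set_one: "S \<subseteq> carrier G \<Longrightarrow> conj_set G \<one> S = S"
  by (force simp: conj_set_def subset_iff image_iff)

lemma conj_set_mult:
  assumes "S \<subseteq> carrier G" "g \<in> carrier G" "h \<in> carrier G"
  shows "conj_set G (g \<otimes> h) S = conj_set G g (conj_set G h S)"
  unfolding conj_set_def image_image
  by (rule image_cong) (use assms in \<open>auto simp: inv_mult_group m_assoc subset_iff\<close>)

lemma conj_set_mono: "S \<subseteq> T \<Longrightarrow> conj_set G g S \<subseteq> conj_set G g T"
  by (auto simp: conj_set_def)

lemma conj_set_inv_cancel: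
  assumes "S \<subseteq> carrier G" "g \<in> carrier G"
  shows "conj_set G (inv g) (conj_set G g S) = S" "conj_set G g (conj_set G (inv g) S) = S"
  using conj_set_mult[of S "inv g" g] conj_set_mult[of S g "inv g"] assms by (simp_all add: conj_set_one)

lemma conj_set_subset_iff:
  assumes "S \<subseteq> carrier G" "T \<subseteq> carrier G" "g \<in> carrier G"
  shows "S \<subseteq> conj_set G g T \<longleftrightarrow> conj_set G (inv g) S \<subseteq> T"
  using conj_set_mono[of S "conj_set G g T" "inv g"] conj_set_mono[of "conj_set G (inv g) S" T g]
    conj_set_inv_cancel[OF assms(1,3)] conj_set_inv_cancel[OF assms(2,3)] by auto

lemma card_conj_set:
  assumes "S \<subseteq> carrier G" "g \<in> carrier G"
  shows "card (conj_set G g S) = card S"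
  unfolding conj_set_def using assms by (intro card_image inj_onI) (auto simp: subset_iff)

lemma subgroup_conj_set: "subgroup H G \<Longrightarrow> g \<in> carrier G \<Longrightarrow> subgroup (conj_set G g H) G"
  using subgroup_conjugation_is_surj2[of g H] by (simp add: conj_set_eq_cosets subgroup.subset)

lemma conj_set_normal:
  assumes "N \<lhd> G" "g \<in> carrier G"
  shows "conj_set G g N = N"
proof -
  interpret N: normal N G by fact
  have "conj_set G h N \<subseteq> N" if "h \<in> carrier G" for h
    using that N.inv_op_closed2 by (auto simp: conj_set_def)
  then show ?thesis
    using conj_set_subset_iff[of N N g] assms(2) N.subset by (simp add: subset_antisym)
qed

lemma conj_set_self:
  assumes "subgroup H G" "g \<in> H"
  shows "conj_set G g H = H"
proof -
  have "conj_set G h H \<subseteq> H" if "h \<in> H" for h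
    using that assms(1) by (auto simp: conj_set_def intro!: subgroup.m_closed subgroup.m_inv_closed)
  from this[OF assms(2)] this[OF subgroup.m_inv_closed[OF assms]] show ?thesis
    using conj_set_subset_iff[of H H g] assms subgroup.subset[OF assms(1)]
    by (meson subset_antisym subsetD)
qed

lemma normalizer_eq:
  assumes "S \<subseteq> carrier G"
  shows "normalizer G S = {g \<in> carrier G. conj_set G g S = S}"
  using assms by (auto simp: normalizer_def stabilizer_def conj_set_eq_cosets)

lemma normalizer_subgroup: "S \<subseteq> carrier G \<Longrightarrow> subgroup (normalizer G S) G"
  using normalizer_imp_subgroup by blast

lemma subgroup_le_normalizer: "subgroup H G \<Longrightarrow> H \<subseteq> normalizer G H"
  using subgroup.subset[of H G] conj_set_self by (auto simp: normalizer_eq)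

text \<open>Conjugation is injective, so on a finite set the inclusion of the conjugate in
  \<open>S\<close> is already an equality.\<close>

lemma mem_normalizerI:
  assumes "finite (carrier G)" "S \<subseteq> carrier G" "g \<in> carrier G"
    and "\<And>s. s \<in> S \<Longrightarrow> g \<otimes> s \<otimes> inv g \<in> S"
  shows "g \<in> normalizer G S"
proof -
  have "conj_set G g S \<subseteq> S" using assms(4) by (auto simp: conj_set_def)
  then have "conj_set G g S = S"
    using card_conj_set[OF assms(2,3)] finite_subset[OF assms(2,1)] by (simp add: card_subset_eq)
  then show ?thesis using assms by (simp add: normalizer_eq)
qed

lemma normalizer_conj_closed:
  assumes "S \<subseteq> carrier G" "g \<in> normalizer G S" "s \<in> S"
  shows "g \<otimes> s \<otimes> inv g \<in> S"
  using assms by (auto simp: normalizer_eq conj_set_def)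

lemma normalizer_eq_carrier_imp_normal:
  assumes "subgroup H G" "normalizer G H = carrier G"
  shows "H \<lhd> G"
  using assms normalizer_conj_closed[of H] subgroup.subset[OF assms(1)] by (intro normal_invI) auto

lemma normalizer_conj_set:
  assumes "S \<subseteq> carrier G" "g \<in> carrier G"
  shows "normalizer G (conj_set G g S) = conj_set G g (normalizer G S)"
proof -
  \<comment> \<open>Proved for every \<open>T\<close> and \<open>h\<close>: the reverse inclusion is
    this one applied to the conjugate of \<open>S\<close> and to \<open>inv g\<close>.\<close>
  have *: "conj_set G h (normalizer G T) \<subseteq> normalizer G (conj_set G h T)"
    if T: "T \<subseteq> carrier G" "h \<in> carrier G" for T h
  proof
    fix x assume "x \<in> conj_set G h (normalizer G T)"
    then obtain n where n: "n \<in> carrier G" "conj_set G n T = T" "x = h \<otimes> n \<otimes> inv h"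
      using T by (auto simp: conj_set_def[of G h] normalizer_eq)
    then have "conj_set G x (conj_set G h T) = conj_set G h T"
      using that by (simp add: conj_set_mult conj_set_subset conj_set_inv_cancel)
    then show "x \<in> normalizer G (conj_set G h T)"
      using that n by (simp add: normalizer_eq conj_set_subset)
  qed
  have "normalizer G (conj_set G g S) \<subseteq> conj_set G g (normalizer G S)"
    using *[of "conj_set G g S" "inv g"] assms
    by (simp add: conj_set_subset_iff conj_set_subset conj_set_inv_cancel normalizer_eq)
  with *[OF assms] show ?thesis by blast
qed

section \<open>Counting products and double cosets of subgroups\<close>

lemma card_subgroup_dvd:
  assumes "subgroup H G" "subgroup K G" "H \<subseteq> K"
  shows "card H dvd card K"
proof -
  interpret K: group "G\<lparr>carrier := K\<rparr>" using subgroup_imp_group[OF assms(2)] .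
  have "subgroup H (G\<lparr>carrier := K\<rparr>)"
    using assms subgroup_incl by blast
  from K.lagrange[OF this] have "card K = card (rcosets\<^bsub>G\<lparr>carrier := K\<rparr>\<^esub> H) * card H"
    by (simp add: order_def)
  then show ?thesis by simp
qed

text \<open>Count \<open>H \<times> K\<close> by the fibres of multiplication: the fibre over
  \<open>a \<otimes> b\<close> is parametrised by \<open>d \<in> H \<inter> K\<close> through
  \<open>(a \<otimes> d, inv d \<otimes> b)\<close>. The product set need not be a subgroup.\<close>

lemma card_set_mult:
  assumes "finite (carrier G)" "subgroup H G" "subgroup K G"
  shows "card (H <#> K) * card (H \<inter> K) = card H * card K"
proof -
  interpret H: subgroup H G by fact
  interpret K: subgroup K G by fact
  have fin: "finite H" "finite K"
    using assms finite_subset subgroup.subset by blast+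
  have fib: "card {(h, k) \<in> H \<times> K. h \<otimes> k = z} = card (H \<inter> K)" if "z \<in> H <#> K" for z
  proof -
    from that obtain a b where ab: "a \<in> H" "b \<in> K" "z = a \<otimes> b" by (auto simp: set_mult_def)
    have "bij_betw (\<lambda>d. (a \<otimes> d, inv d \<otimes> b)) (H \<inter> K) {(h, k) \<in> H \<times> K. h \<otimes> k = z}"
    proof (rule bij_betwI[where g = "\<lambda>(h, k). inv a \<otimes> h"])
      show "(\<lambda>d. (a \<otimes> d, inv d \<otimes> b)) \<in> H \<inter> K \<rightarrow> {(h, k) \<in> H \<times> K. h \<otimes> k = z}"
      proof
        fix d assume d: "d \<in> H \<inter> K"
        then have "a \<otimes> d \<otimes> (inv d \<otimes> b) = a \<otimes> b" using ab by (simp add: m_assoc)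
        then show "(a \<otimes> d, inv d \<otimes> b) \<in> {(h, k) \<in> H \<times> K. h \<otimes> k = z}"
          using ab d by simp
      qed
      show "(\<lambda>(h, k). inv a \<otimes> h) \<in> {(h, k) \<in> H \<times> K. h \<otimes> k = z} \<rightarrow> H \<inter> K"
      proof
        fix y assume "y \<in> {(h, k) \<in> H \<times> K. h \<otimes> k = z}"
        then obtain h k where hk: "y = (h, k)" "h \<in> H" "k \<in> K" "h \<otimes> k = a \<otimes> b" using ab by auto
        have "h = h \<otimes> k \<otimes> inv k" using hk(2,3) by (simp add: m_assoc)
        also have "\<dots> = a \<otimes> (b \<otimes> inv k)" unfolding hk(4) using ab hk by (simp add: m_assoc)
        finally have "inv a \<otimes> h = inv a \<otimes> (a \<otimes> (b \<otimes> inv k))" by simp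
        also have "\<dots> = b \<otimes> inv k"
          using ab hk by simp
        finally have "inv a \<otimes> h = b \<otimes> inv k" .
        moreover have "inv a \<otimes> h \<in> H" "b \<otimes> inv k \<in> K" using hk ab by simp_all
        ultimately show "(\<lambda>(h, k). inv a \<otimes> h) y \<in> H \<inter> K" using hk by simp
      qed
      show "(\<lambda>(h, k). inv a \<otimes> h) (a \<otimes> x, inv x \<otimes> b) = x" if "x \<in> H \<inter> K" for x
        using that ab by simp
      show "(\<lambda>d. (a \<otimes> d, inv d \<otimes> b)) ((\<lambda>(h, k). inv a \<otimes> h) y) = y"
        if y: "y \<in> {(h, k) \<in> H \<times> K. h \<otimes> k = z}" for y
      proof -
        obtain h k where hk: "y = (h, k)" "h \<in> H" "k \<in> K" "h \<otimes> k = a \<otimes> b" using y ab by auto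
        have "a \<otimes> (inv a \<otimes> h) = h" using ab hk by simp
        moreover have "inv (inv a \<otimes> h) \<otimes> b = inv h \<otimes> (h \<otimes> k)"
          unfolding hk(4) using ab hk by (simp add: inv_mult_group m_assoc)
        moreover have "inv h \<otimes> (h \<otimes> k) = k" using hk(2,3) by simp
        ultimately show ?thesis using hk by simp
      qed
    qed
    from bij_betw_same_card[OF this] show ?thesis by simp
  qed
  have "H \<times> K = (\<Union>z\<in>H <#> K. {(h, k) \<in> H \<times> K. h \<otimes> k = z})"
    by (auto simp: set_mult_def)
  then have "card (H \<times> K) = card (\<Union>z\<in>H <#> K. {(h, k) \<in> H \<times> K. h \<otimes> k = z})"
    by (rule arg_cong)
  also have "\<dots> = (\<Sum>z\<in>H <#> K. card {(h, k) \<in> H \<times> K. h \<otimes> k = z})"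
  proof (rule card_UN_disjoint)
    show "finite (H <#> K)" using fin by (auto simp: set_mult_def)
    show "\<forall>z\<in>H <#> K. finite {(h, k) \<in> H \<times> K. h \<otimes> k = z}"
      using fin by (auto intro: finite_subset[of _ "H \<times> K"])
  qed auto
  also have "\<dots> = card (H <#> K) * card (H \<inter> K)" using fib by simp
  finally show ?thesis by (simp add: card_cartesian_product)
qed

text \<open>The set \<open>A\<close> is a union of double cosets \<open>Q a P\<close>, and \<open>Q a P\<close> has
  \<open>card P * card Q / card (a\<inverse> Q a \<inter> P)\<close> elements.\<close>

lemma prime_dvd_card_double_cosets:
  assumes fin: "finite (carrier G)" and p: "prime p"
    and P: "subgroup P G" and Q: "subgroup Q G" "card Q = p ^ b"
    and A: "A \<subseteq> carrier G" "\<And>q a u. q \<in> Q \<Longrightarrow> a \<in> A \<Longrightarrow> u \<in> P \<Longrightarrow> q \<otimes> a \<otimes> u \<in> A"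
    and not_sub: "\<And>a. a \<in> A \<Longrightarrow> \<not> conj_set G (inv a) Q \<subseteq> P"
  shows "p * card P dvd card A"
proof -
  interpret P: subgroup P G by fact
  interpret Q: subgroup Q G by fact
  define r where "r = {(x, y) \<in> A \<times> A. \<exists>q\<in>Q. \<exists>u\<in>P. y = q \<otimes> x \<otimes> u}"
  have "equiv A r"
  proof (rule equivI)
    show "r \<subseteq> A \<times> A" by (auto simp: r_def)
    show "refl_on A r"
    proof (rule refl_onI)
      fix x assume "x \<in> A"
      then have "x = \<one> \<otimes> x \<otimes> \<one>" using A by auto
      then show "(x, x) \<in> r" using \<open>x \<in> A\<close> by (force simp: r_def)
    qed
    show "sym r"
    proof (rule symI)
      fix x y assume "(x, y) \<in> r"
      then obtain q u where qu: "x \<in> A" "y \<in> A" "q \<in> Q" "u \<in> P" "y = q \<otimes> x \<otimes> u" by (auto simp: r_def)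
      moreover have "x \<in> carrier G" using qu A by auto
      ultimately have "x = inv q \<otimes> y \<otimes> inv u"
        by (simp add: m_assoc inv_solve_left)
      then show "(y, x) \<in> r" using qu by (auto simp: r_def)
    qed
    show "trans r"
    proof (rule transI)
      fix x y z assume "(x, y) \<in> r" "(y, z) \<in> r"
      then obtain q u q' u' where qu: "x \<in> A" "z \<in> A" "q \<in> Q" "u \<in> P" "q' \<in> Q" "u' \<in> P"
        "z = q' \<otimes> (q \<otimes> x \<otimes> u) \<otimes> u'" by (auto simp: r_def)
      moreover have "x \<in> carrier G" using qu A by auto
      ultimately have "z = (q' \<otimes> q) \<otimes> x \<otimes> (u \<otimes> u')" by (simp add: m_assoc)
      then show "(x, z) \<in> r" using qu by (auto simp: r_def)
    qed
  qed
  moreover have "p * card P dvd card X" if "X \<in> A // r" for X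
  proof -
    from that obtain a where a: "a \<in> A" "X = r `` {a}" by (auto elim: quotientE)
    have ac: "a \<in> carrier G" using a A by auto
    let ?Q = "conj_set G (inv a) Q"
    have sQ: "subgroup ?Q G" using Q ac by (simp add: subgroup_conj_set)
    have cQ: "card ?Q = p ^ b" using Q ac by (simp add: card_conj_set Q.subset)
    \<comment> \<open>The double coset is a left translate by \<open>a\<close> of the product of the
      subgroups \<open>a^-1 Q a\<close> and \<open>P\<close>, to which \<open>card_set_mult\<close>
      applies.\<close>
    have X: "X = (\<lambda>y. a \<otimes> y) ` (?Q <#> P)"
    proof -
      have "X = {q \<otimes> a \<otimes> u | q u. q \<in> Q \<and> u \<in> P}"
        using a A(2) by (auto simp: r_def)
      moreover have "a \<otimes> (inv a \<otimes> q \<otimes> inv (inv a) \<otimes> u) = q \<otimes> a \<otimes> u" if "q \<in> Q" "u \<in> P" for q u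
        using that ac by (simp add: m_assoc)
      moreover have "(\<lambda>y. a \<otimes> y) ` (?Q <#> P)
          = {a \<otimes> (inv a \<otimes> q \<otimes> inv (inv a) \<otimes> u) | q u. q \<in> Q \<and> u \<in> P}"
        unfolding set_mult_def conj_set_def by blast
      ultimately show ?thesis by (smt (verit) Collect_cong)
    qed
    have "?Q <#> P \<subseteq> carrier G"
      using subgroup.subset[OF sQ] P.subset by (rule set_mult_closed)
    then have "card X = card (?Q <#> P)"
      unfolding X using ac by (intro card_image inj_onI) (auto simp: subset_iff)
    moreover have "card (?Q <#> P) * card (?Q \<inter> P) = p ^ b * card P"
      using card_set_mult[OF fin sQ P] cQ by simp
    moreover obtain i where i: "i \<le> b" "card (?Q \<inter> P) = p ^ i"
      using card_subgroup_dvd[OF subgroups_Inter_pair[OF sQ P] sQ] cQ p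
      by (auto simp: divides_primepow_nat)
    \<comment> \<open>The conjugate of \<open>Q\<close> is not contained in \<open>P\<close>, so the
      intersection is proper in it, and \<open>p ^ (b - i)\<close> supplies the extra factor
      \<open>p\<close>.\<close>
    moreover have "i \<noteq> b"
    proof
      assume "i = b"
      then have "?Q \<inter> P = ?Q" using i cQ fin finite_subset[OF subgroup.subset[OF sQ]]
        by (intro card_subset_eq) auto
      then show False using not_sub[OF a(1)] by auto
    qed
    ultimately have "card X * p ^ i = p ^ i * (p ^ (b - i) * card P)"
      by (simp add: power_add[symmetric] mult.assoc[symmetric])
    then have "card X = p ^ (b - i) * card P" using p by (simp add: prime_gt_0_nat)
    moreover have "p dvd p ^ (b - i)" using \<open>i \<le> b\<close> \<open>i \<noteq> b\<close> by (simp add: dvd_power)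
    ultimately show ?thesis by simp
  qed
  ultimately show ?thesis
    using equiv_imp_dvd_card[of A r] finite_subset[OF A(1) fin] by blast
qed

end

section \<open>Sylow subgroups\<close>

text \<open>\<open>K\<close> and \<open>P\<close> are both kept as subsets of the ambient
  \<open>G\<close>, so that conjugation by elements outside \<open>K\<close> makes sense. If
  \<open>p\<close> does not divide \<open>card K\<close>, then \<open>P\<close> is trivial.\<close>

definition sylow_subgroup :: "('a, 'b) monoid_scheme \<Rightarrow> nat \<Rightarrow> 'a set \<Rightarrow> 'a set \<Rightarrow> bool" where
  "sylow_subgroup G p K P \<longleftrightarrow> subgroup P G \<and> P \<subseteq> K \<and> card P = p ^ multiplicity p (card K)"

context group
begin

lemma card_subgroup_pos: "finite (carrier G) \<Longrightarrow> subgroup H G \<Longrightarrow> 0 < card H"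
  using subgroup.one_closed subgroup.subset finite_subset by (metis card_gt_0_iff empty_iff)

lemma sylow_subgroup_exists:
  assumes "finite (carrier G)" "prime p" "subgroup K G"
  shows "\<exists>P. sylow_subgroup G p K P"
proof -
  interpret K: group "G\<lparr>carrier := K\<rparr>" using subgroup_imp_group[OF assms(3)] .
  have "finite K" using assms finite_subset subgroup.subset by blast
  have "order (G\<lparr>carrier := K\<rparr>) = p ^ multiplicity p (card K) * (card K div p ^ multiplicity p (card K))"
    by (simp add: order_def multiplicity_dvd)
  from sylow_thm[OF assms(2) K.is_group this] \<open>finite K\<close>
  obtain P where "subgroup P (G\<lparr>carrier := K\<rparr>)" "card P = p ^ multiplicity p (card K)" by auto
  then show ?thesis
    using incl_subgroup[OF assms(3)] subgroup.subset by (force simp: sylow_subgroup_def)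
qed

text \<open>If no conjugate of \<open>P\<close> contained \<open>Q\<close>, counting
  \<open>K\<close> by double cosets \<open>Q a P\<close> would give
  \<open>p * card P dvd card K\<close>, although \<open>card P\<close> is the full
  \<open>p\<close>-part of \<open>card K\<close>.\<close>

lemma sylow_contains_conj:
  assumes fin: "finite (carrier G)" and p: "prime p" and K: "subgroup K G"
    and P: "sylow_subgroup G p K P" and Q: "subgroup Q G" "Q \<subseteq> K" "card Q = p ^ b"
  shows "\<exists>g\<in>K. Q \<subseteq> conj_set G g P"
proof (rule ccontr)
  assume neg: "\<not> ?thesis"
  interpret K: subgroup K G by fact
  have PK: "subgroup P G" "P \<subseteq> K" "card P = p ^ multiplicity p (card K)"
    using P by (auto simp: sylow_subgroup_def)
  have sub: "Q \<subseteq> carrier G" "P \<subseteq> carrier G" using Q PK subgroup.subset by blast+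
  have "p * card P dvd card K"
  proof (rule prime_dvd_card_double_cosets[OF fin p PK(1) Q(1,3)])
    show "K \<subseteq> carrier G" by (rule K.subset)
    show "q \<otimes> a \<otimes> u \<in> K" if "q \<in> Q" "a \<in> K" "u \<in> P" for q a u
      using that Q PK by (intro K.m_closed) auto
    show "\<not> conj_set G (inv a) Q \<subseteq> P" if "a \<in> K" for a
      using neg that conj_set_subset_iff[OF sub, of a] by (auto simp: K.mem_carrier)
  qed
  then have "p ^ Suc (multiplicity p (card K)) dvd card K" using PK by simp
  moreover have "card K \<noteq> 0"
    using card_subgroup_pos[OF fin K] by simp
  ultimately show False
    using p by (metis not_dvd_imp_multiplicity_0 multiplicity_geI not_less_eq_eq le_refl prime_elem_multiplicity_eq_zero_iff not_prime_unit)
qed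

lemma sylow_conjugate:
  assumes fin: "finite (carrier G)" and p: "prime p" and K: "subgroup K G"
    and P: "sylow_subgroup G p K P" and Q: "sylow_subgroup G p K Q"
  shows "\<exists>g\<in>K. Q = conj_set G g P"
proof -
  have sub: "P \<subseteq> carrier G" using P subgroup.subset unfolding sylow_subgroup_def by blast
  obtain g where g: "g \<in> K" "Q \<subseteq> conj_set G g P"
    using sylow_contains_conj[OF fin p K P] Q unfolding sylow_subgroup_def by blast
  moreover have gc: "g \<in> carrier G" using g K subgroup.subset by blast
  moreover have "card (conj_set G g P) = card Q"
    using P Q card_conj_set[OF sub gc] by (simp add: sylow_subgroup_def)
  ultimately have "Q = conj_set G g P"
    using finite_subset[OF conj_set_subset[OF sub gc] fin] by (simp add: card_subset_eq)
  then show ?thesis using g by blast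
qed

text \<open>The conjugate of \<open>S\<close> by any \<open>g\<close> is again Sylow in the normal
  subgroup \<open>L\<close>, hence equals the conjugate by some \<open>l \<in> L\<close>; then
  \<open>inv l \<otimes> g\<close> normalizes \<open>S\<close>.\<close>

lemma frattini:
  assumes fin: "finite (carrier G)" and p: "prime p" and L: "L \<lhd> G"
    and S: "sylow_subgroup G p L S"
  shows "L <#> normalizer G S = carrier G"
proof
  interpret L: normal L G by fact
  have sub: "S \<subseteq> carrier G" using S subgroup.subset unfolding sylow_subgroup_def by blast
  show "L <#> normalizer G S \<subseteq> carrier G"
    using L.subset normalizer_subgroup[OF sub, THEN subgroup.subset] by (rule set_mult_closed)
  show "carrier G \<subseteq> L <#> normalizer G S"
  proof
    fix g assume g: "g \<in> carrier G"
    have "sylow_subgroup G p L (conj_set G g S)"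
      using S g sub conj_set_mono[of S L g] conj_set_normal[OF L g]
      by (simp add: sylow_subgroup_def subgroup_conj_set card_conj_set)
    then obtain l where l: "l \<in> L" "conj_set G g S = conj_set G l S"
      using sylow_conjugate[OF fin p L.is_subgroup S] by blast
    then have lc: "l \<in> carrier G" by auto
    then have "conj_set G (inv l \<otimes> g) S = S"
      using l g sub by (simp add: conj_set_mult conj_set_inv_cancel)
    then have "inv l \<otimes> g \<in> normalizer G S" using g lc sub by (simp add: normalizer_eq)
    moreover have "g = l \<otimes> (inv l \<otimes> g)" using g lc by simp
    ultimately show "g \<in> L <#> normalizer G S" using l(1) unfolding set_mult_def by blast
  qed
qed

text \<open>If no element of \<open>P - T\<close> normalizes \<open>T\<close>, every double coset
  \<open>T x T\<close> in \<open>P - T\<close> has order divisible by \<open>p * card T\<close>.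
  This number then divides \<open>card (P - T)\<close>, and it divides \<open>card P\<close> because
  \<open>T\<close> is proper in a \<open>p\<close>-group; so it would divide
  \<open>card T\<close>.\<close>

lemma p_subgroup_normalizer_grows:
  assumes fin: "finite (carrier G)" and p: "prime p"
    and P: "subgroup P G" "card P = p ^ a" and T: "subgroup T G" "T \<subset> P"
  shows "\<exists>x\<in>P - T. x \<in> normalizer G T"
proof (rule ccontr)
  assume neg: "\<not> ?thesis"
  interpret P: subgroup P G by fact
  interpret T: subgroup T G by fact
  have finP: "finite P" "finite T" using finite_subset[OF P.subset fin] finite_subset[OF T.subset fin] .
  obtain b where b: "card T = p ^ b" "b \<le> a"
    using card_subgroup_dvd[OF T(1) P(1)] T(2) P(2) p by (auto simp: divides_primepow_nat)
  have "p * card T dvd card (P - T)"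
  proof (rule prime_dvd_card_double_cosets[OF fin p T(1) T(1) b(1)])
    show "P - T \<subseteq> carrier G" using P.subset by auto
    show "q \<otimes> x \<otimes> u \<in> P - T" if "q \<in> T" "x \<in> P - T" "u \<in> T" for q x u
    proof -
      have P': "q \<in> P" "u \<in> P" "x \<in> P" using that T by auto
      then have "x = inv q \<otimes> (q \<otimes> x \<otimes> u) \<otimes> inv u"
        using that by (simp add: m_assoc)
      then have "q \<otimes> x \<otimes> u \<notin> T"
        using that by (metis DiffE T.m_closed T.m_inv_closed)
      then show ?thesis using P' by simp
    qed
    show "\<not> conj_set G (inv x) T \<subseteq> T" if "x \<in> P - T" for x
    proof
      assume sub: "conj_set G (inv x) T \<subseteq> T"
      have xc: "x \<in> carrier G" using that P.subset by auto
      have "conj_set G (inv x) T = T"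
        using sub card_conj_set[OF T.subset, of "inv x"] xc finP by (simp add: card_subset_eq)
      then have "conj_set G x T = T"
        using conj_set_inv_cancel(2)[OF T.subset xc] by simp
      then show False using neg that xc T.subset by (auto simp: normalizer_eq)
    qed
  qed
  moreover have "card P = card T + card (P - T)"
    using T(2) finP by (metis card_Un_disjoint Diff_disjoint Diff_partition finite_Diff psubset_imp_subset)
  moreover have "p * card T dvd card P"
  proof -
    have "b \<noteq> a" using T(2) b P(2) finP by (metis psubset_card_mono less_irrefl)
    then have "Suc b \<le> a" using b by simp
    then show ?thesis using b P by (metis le_imp_power_dvd power_Suc)
  qed
  ultimately have "p * card T dvd card T" by (metis dvd_add_left_iff)
  moreover have "card T > 0" using card_subgroup_pos[OF fin T(1)] .
  ultimately show False using dvd_imp_le[of "p * card T" "card T"] prime_gt_1_nat[OF p] by simp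
qed

text \<open>Let \<open>P\<close> be a Sylow subgroup of \<open>G\<close> containing
  \<open>T\<close>. The part of \<open>P\<close> normalizing \<open>T\<close> lies in a conjugate of
  \<open>T\<close> by a normalizing element, that is, in \<open>T\<close>; by growth of normalizers
  \<open>T\<close> cannot be proper in \<open>P\<close>.\<close>

lemma sylow_in_normalizer_imp_sylow:
  assumes fin: "finite (carrier G)" and p: "prime p" and T: "sylow_subgroup G p (normalizer G T) T"
  shows "sylow_subgroup G p (carrier G) T"
proof -
  have sT: "subgroup T G" and cT: "card T = p ^ multiplicity p (card (normalizer G T))"
    using T by (auto simp: sylow_subgroup_def)
  have subT: "T \<subseteq> carrier G" using sT subgroup.subset by blast
  obtain P0 where P0: "sylow_subgroup G p (carrier G) P0"
    using sylow_subgroup_exists[OF fin p subgroup_self] by blast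
  then have sub0: "P0 \<subseteq> carrier G" by (simp add: sylow_subgroup_def)
  obtain g where g: "g \<in> carrier G" "T \<subseteq> conj_set G g P0"
    using sylow_contains_conj[OF fin p subgroup_self P0 sT subT cT] by blast
  define P where "P = conj_set G g P0"
  have P: "sylow_subgroup G p (carrier G) P"
    using P0 g sub0 by (simp add: P_def sylow_subgroup_def subgroup_conj_set card_conj_set conj_set_subset)
  then have sP: "subgroup P G" and cP: "card P = p ^ multiplicity p (card (carrier G))"
    by (auto simp: sylow_subgroup_def)
  have "T = P"
  proof (rule ccontr)
    assume "T \<noteq> P"
    then have "T \<subset> P" using g P_def by auto
    from p_subgroup_normalizer_grows[OF fin p sP cP sT this]
    obtain x where x: "x \<in> P" "x \<notin> T" "x \<in> normalizer G T" by auto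
    have sN: "subgroup (normalizer G T) G" using normalizer_subgroup[OF subT] .
    have sI: "subgroup (P \<inter> normalizer G T) G" using subgroups_Inter_pair[OF sP sN] .
    obtain b where b: "card (P \<inter> normalizer G T) = p ^ b"
      using card_subgroup_dvd[OF sI sP] cP p by (auto simp: divides_primepow_nat)
    from sylow_contains_conj[OF fin p sN T sI _ b]
    obtain n where n: "n \<in> normalizer G T" "P \<inter> normalizer G T \<subseteq> conj_set G n T" by auto
    moreover have "conj_set G n T = T" using n subT by (simp add: normalizer_eq)
    ultimately show False using x by auto
  qed
  then show ?thesis using P by simp
qed

section \<open>Solvability of groups of prime power order\<close>

lemma prime_order_comm_group:
  assumes "finite (carrier G)" "prime (order G)"
  shows "comm_group G"
proof -
  have "carrier G \<noteq> {\<one>}" using assms(2) by (auto simp: order_def)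
  then obtain x where x: "x \<in> carrier G" "x \<noteq> \<one>" by auto
  have s: "subgroup (generate G {x}) G" using x by (intro generate_is_subgroup) auto
  have "card (generate G {x}) dvd order G" using lagrange[OF s] by (metis dvd_triv_right)
  moreover have "card (generate G {x}) \<noteq> 1"
    using x generate.incl[of x "{x}" G] generate.one[of G "{x}"] by (metis card_1_singletonE singletonD insertI1)
  ultimately have "card (generate G {x}) = order G" using assms(2) by (auto simp: prime_nat_iff)
  then have "generate G {x} = carrier G"
    using assms(1) subgroup.subset[OF s] by (simp add: card_subset_eq order_def)
  then have gen: "carrier G = {x [^] (k::int) | k. k \<in> UNIV}" using generate_pow[OF x(1)] by simp
  show ?thesis
  proof (rule group_comm_groupI)
    fix y z assume "y \<in> carrier G" "z \<in> carrier G"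
    then obtain i j :: int where "y = x [^] i" "z = x [^] j" using gen by auto
    then show "y \<otimes> z = z \<otimes> y" using x by (simp add: int_pow_mult[symmetric] add.commute)
  qed
qed

text \<open>Sylow's theorem gives a subgroup \<open>H\<close> of index \<open>p\<close>. Its
  normalizer in \<open>P\<close> is strictly larger, hence all of \<open>P\<close>, and
  \<open>P / H\<close> has prime order, so it is abelian.\<close>

lemma p_subgroup_solvable:
  assumes fin: "finite (carrier G)" and p: "prime p"
  shows "subgroup P G \<Longrightarrow> card P = p ^ a \<Longrightarrow> solvable_seq G P"
proof (induction a arbitrary: P)
  case 0
  then have "P = {\<one>}" using subgroup.one_closed[OF 0(1)] by (auto simp: card_1_singleton_iff)
  then show ?case using solvable_seq.unity by simp
next
  case (Suc a)
  interpret P: group "G\<lparr>carrier := P\<rparr>" using subgroup_imp_group[OF Suc(2)] .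
  have finP: "finite P" using finite_subset[OF subgroup.subset[OF Suc(2)] fin] .
  have "order (G\<lparr>carrier := P\<rparr>) = p ^ a * p" using Suc(3) by (simp add: order_def)
  from sylow_thm[OF p P.is_group this] finP
  obtain H where "subgroup H (G\<lparr>carrier := P\<rparr>)" and cH: "card H = p ^ a" by auto
  then have H: "subgroup H G" "H \<subseteq> P"
    using incl_subgroup[OF Suc(2)] subgroup.subset by force+
  have "H \<noteq> P" using cH Suc(3) prime_gt_1_nat[OF p] by auto
  then obtain x where x: "x \<in> P" "x \<notin> H" "x \<in> normalizer G H"
    using p_subgroup_normalizer_grows[OF fin p Suc(2,3) H(1)] H(2) by auto
  have sN: "subgroup (P \<inter> normalizer G H) G"
    using subgroups_Inter_pair[OF Suc(2)] normalizer_subgroup[OF subgroup.subset[OF H(1)]] .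
  obtain b where b: "card (P \<inter> normalizer G H) = p ^ b" "b \<le> Suc a"
    using card_subgroup_dvd[OF sN Suc(2)] Suc(3) p
    by (auto simp: divides_primepow_nat simp del: power_Suc)
  have "H \<subset> P \<inter> normalizer G H" using H subgroup_le_normalizer x by auto
  then have "p ^ a < p ^ b" using psubset_card_mono[of "P \<inter> normalizer G H" H] finP b cH by simp
  then have "a < b" using prime_gt_1_nat[OF p] by (simp add: power_strict_increasing_iff)
  then have "b = Suc a" using b by simp
  then have "card (P \<inter> normalizer G H) = card P" using b Suc(3) by simp
  then have PN: "P \<subseteq> normalizer G H" using finP card_subset_eq[of P "P \<inter> normalizer G H"] by auto
  have sHP: "subgroup H (G\<lparr>carrier := P\<rparr>)" using subgroup_incl[OF H(1) Suc(2) H(2)] .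
  have nor: "H \<lhd> (G\<lparr>carrier := P\<rparr>)"
  proof (rule P.normal_invI[OF sHP])
    fix y h assume "y \<in> carrier (G\<lparr>carrier := P\<rparr>)" "h \<in> H"
    then show "y \<otimes>\<^bsub>G\<lparr>carrier := P\<rparr>\<^esub> h \<otimes>\<^bsub>G\<lparr>carrier := P\<rparr>\<^esub> inv\<^bsub>G\<lparr>carrier := P\<rparr>\<^esub> y \<in> H"
      using normalizer_conj_closed[OF subgroup.subset[OF H(1)], of y h] PN
      by (auto simp: m_inv_consistent[OF Suc(2)])
  qed
  interpret Q: group "(G\<lparr>carrier := P\<rparr>) Mod H" using normal.factorgroup_is_group[OF nor] .
  have "card (rcosets\<^bsub>G\<lparr>carrier := P\<rparr>\<^esub> H) * card H = card P"
    using P.lagrange[OF sHP] by (simp add: order_def)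
  then have "order ((G\<lparr>carrier := P\<rparr>) Mod H) = p"
    using Suc(3) cH prime_gt_0_nat[OF p] by (simp add: order_def FactGroup_def)
  then have "comm_group ((G\<lparr>carrier := P\<rparr>) Mod H)"
    using Q.prime_order_comm_group p prime_gt_0_nat[OF p] Q.order_gt_0_iff_finite by simp
  then show ?case using solvable_seq.extension[OF Suc.IH[OF H(1) cH] nor Suc(2)] by blast
qed

end

section \<open>Nilpotent groups\<close>

context group
begin

lemma lower_central_subset: "lower_central G n \<subseteq> carrier G"
proof (induction n)
  case (Suc n)
  then show ?case unfolding lower_central.simps by (intro generate_incl) auto
qed simp

lemma commutator_in_lower_central:
  assumes "x \<in> lower_central G n" "y \<in> carrier G"
  shows "x \<otimes> y \<otimes> inv x \<otimes> inv y \<in> lower_central G (Suc n)"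
  unfolding lower_central.simps using assms by (intro generate.incl) blast

text \<open>Some term of the lower central series is not inside \<open>H\<close> while the next one
  is. An element \<open>x\<close> of it outside \<open>H\<close> has all commutators with
  \<open>H\<close> in that next term, hence in \<open>H\<close>, so \<open>x\<close> normalizes
  \<open>H\<close>.\<close>

lemma nilpotent_normalizer_grows:
  assumes fin: "finite (carrier G)" and nil: "nilpotent_group G"
    and H: "subgroup H G" "H \<noteq> carrier G"
  shows "\<exists>x\<in>carrier G - H. x \<in> normalizer G H"
proof -
  interpret H: subgroup H G by fact
  obtain n where n: "lower_central G n = {\<one>}" using nil by (auto simp: nilpotent_group_def)
  have "\<not> lower_central G 0 \<subseteq> H" using H.subset H(2) by auto
  moreover have "lower_central G n \<subseteq> H" using n by simp
  ultimately obtain i where i: "\<not> lower_central G i \<subseteq> H" "lower_central G (Suc i) \<subseteq> H"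
    using ex_least_nat_less[of "\<lambda>n. lower_central G n \<subseteq> H" n] by blast
  then obtain x where x: "x \<in> lower_central G i" "x \<notin> H" by auto
  have xc: "x \<in> carrier G" using x lower_central_subset by auto
  have "x \<otimes> h \<otimes> inv x \<in> H" if "h \<in> H" for h
  proof -
    have "x \<otimes> h \<otimes> inv x \<otimes> inv h \<otimes> h \<in> H"
      using commutator_in_lower_central[OF x(1), of h] i(2) that by auto
    then show ?thesis using that xc by (simp add: m_assoc)
  qed
  then show ?thesis using x xc mem_normalizerI[OF fin H.subset xc] by blast
qed

lemma sylow_subgroup_mono:
  assumes fin: "finite (carrier G)" and p: "prime p" and M: "subgroup M G" and K: "subgroup K G"
    and P: "sylow_subgroup G p K P" "P \<subseteq> M" "M \<subseteq> K"
  shows "sylow_subgroup G p M P"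
proof -
  have sP: "subgroup P G" "card P = p ^ multiplicity p (card K)"
    using P by (auto simp: sylow_subgroup_def)
  have "card M dvd card K" "p ^ multiplicity p (card K) dvd card M"
    using card_subgroup_dvd[OF M K P(3)] card_subgroup_dvd[OF sP(1) M P(2)] sP(2) by simp_all
  then have "multiplicity p (card M) = multiplicity p (card K)"
    using card_subgroup_pos[OF fin] M K p sP
    by (intro antisym dvd_imp_multiplicity_le multiplicity_geI) auto
  then show ?thesis using P sP by (simp add: sylow_subgroup_def)
qed

text \<open>The normalizer \<open>N\<close> of \<open>T\<close> is self-normalizing: if
  \<open>x\<close> normalizes \<open>N\<close>, it carries \<open>T\<close> to a Sylow subgroup of
  \<open>N\<close>, which is conjugate to \<open>T\<close> in \<open>N\<close> and so equals
  \<open>T\<close>. In a nilpotent group this forces \<open>N = carrier G\<close>.\<close>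

lemma nilpotent_sylow_normal:
  assumes fin: "finite (carrier G)" and nil: "nilpotent_group G" and p: "prime p"
    and T: "sylow_subgroup G p (carrier G) T"
  shows "T \<lhd> G"
proof -
  have sT: "subgroup T G" using T by (simp add: sylow_subgroup_def)
  have subT: "T \<subseteq> carrier G" using sT by (rule subgroup.subset)
  define N where "N = normalizer G T"
  have N: "subgroup N G" "T \<subseteq> N"
    using normalizer_subgroup[OF subT] subgroup_le_normalizer[OF sT] by (auto simp: N_def)
  have subN: "N \<subseteq> carrier G" using N(1) by (rule subgroup.subset)
  have TN: "sylow_subgroup G p N T"
    using sylow_subgroup_mono[OF fin p N(1) subgroup_self T N(2) subN] .
  have "N = carrier G"
  proof (rule ccontr)
    assume "N \<noteq> carrier G"
    from nilpotent_normalizer_grows[OF fin nil N(1) this]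
    obtain x where x: "x \<in> carrier G" "x \<notin> N" "conj_set G x N = N"
      using subN by (auto simp: normalizer_eq)
    have "sylow_subgroup G p N (conj_set G x T)"
      using TN x sT conj_set_mono[OF N(2), of x]
      by (simp add: sylow_subgroup_def subgroup_conj_set card_conj_set subT)
    then obtain n where "n \<in> N" "conj_set G x T = conj_set G n T"
      using sylow_conjugate[OF fin p N(1) TN] by blast
    then have "conj_set G x T = T" using subT by (simp add: N_def normalizer_eq)
    then show False using x subT by (simp add: N_def normalizer_eq)
  qed
  then show ?thesis using normalizer_eq_carrier_imp_normal[OF sT] N_def by simp
qed

text \<open>Used to show that a subgroup is the whole group once it contains a Sylow subgroup for
  each prime.\<close>

lemma dvd_if_multiplicity_le:
  fixes a b :: nat
  assumes "a \<noteq> 0" "\<And>q. prime q \<Longrightarrow> q dvd a \<Longrightarrow> q ^ multiplicity q a dvd b"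
  shows "a dvd b"
proof (cases "b = 0")
  case False
  have "multiplicity q a \<le> multiplicity q b" if "prime q" for q
  proof (cases "q dvd a")
    case True
    show ?thesis
      by (rule multiplicity_geI) (use assms(2)[OF that True] that False in \<open>auto simp: prime_gt_1_nat\<close>)
  qed (simp add: not_dvd_imp_multiplicity_0)
  then show ?thesis using assms(1) by (intro multiplicity_le_imp_dvd) auto
qed simp

text \<open>With \<open>C\<close> the centralizer of \<open>T\<close>, the product
  \<open>T <#> C\<close> contains a Sylow subgroup for each prime \<open>q\<close>: for
  \<open>q = p\<close> it is \<open>T\<close>; otherwise it is normal, meets \<open>T\<close>
  trivially and so commutes with \<open>T\<close>. Hence the product is all of
  \<open>G\<close>.\<close>

lemma nilpotent_eq_sylow_mult_centralizer:
  assumes fin: "finite (carrier G)" and nil: "nilpotent_group G" and p: "prime p"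
    and T: "sylow_subgroup G p (carrier G) T" and g: "g \<in> carrier G"
  shows "\<exists>t\<in>T. \<exists>c\<in>carrier G. g = t \<otimes> c \<and> (\<forall>s\<in>T. c \<otimes> s = s \<otimes> c)"
proof -
  have nT: "T \<lhd> G" using nilpotent_sylow_normal[OF fin nil p T] .
  interpret T: normal T G by fact
  define C where "C = {c \<in> carrier G. \<forall>s\<in>T. c \<otimes> s = s \<otimes> c}"
  have sC: "subgroup C G"
  proof (rule subgroupI)
    fix a assume a: "a \<in> C"
    have "inv a \<otimes> s = s \<otimes> inv a" if "s \<in> T" for s
    proof -
      have ac: "a \<in> carrier G" "a \<otimes> s = s \<otimes> a" using a that by (simp_all add: C_def)
      then have "inv a \<otimes> (s \<otimes> a) \<otimes> inv a = inv a \<otimes> (a \<otimes> s) \<otimes> inv a" by simp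
      then show ?thesis using ac(1) that by (simp add: m_assoc)
    qed
    then show "inv a \<in> C" using a by (simp add: C_def)
  next
    fix a b assume ab: "a \<in> C" "b \<in> C"
    have "a \<otimes> b \<otimes> s = s \<otimes> (a \<otimes> b)" if "s \<in> T" for s
    proof -
      have "a \<in> carrier G" "b \<in> carrier G" "a \<otimes> s = s \<otimes> a" "b \<otimes> s = s \<otimes> b"
        using ab that by (simp_all add: C_def)
      then show ?thesis using that by (metis T.mem_carrier m_assoc)
    qed
    then show "a \<otimes> b \<in> C" using ab by (simp add: C_def)
  qed (auto simp: C_def)
  have D: "subgroup (T <#> C) G" using mult_norm_subgroup[OF nT sC] .
  have TC: "T \<subseteq> T <#> C" "C \<subseteq> T <#> C"
  proof -
    have "t \<otimes> \<one> \<in> T <#> C" if "t \<in> T" for t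
      using that subgroup.one_closed[OF sC] unfolding set_mult_def by blast
    then show "T \<subseteq> T <#> C" using T.mem_carrier by auto
    have "\<one> \<otimes> c \<in> T <#> C" if "c \<in> C" for c
      using that T.one_closed unfolding set_mult_def by blast
    then show "C \<subseteq> T <#> C" by (auto simp: C_def)
  qed
  have q_part: "q ^ multiplicity q (order G) dvd card (T <#> C)" if q: "prime q" "q dvd order G" for q
  proof -
    obtain S where S: "sylow_subgroup G q (carrier G) S"
      using sylow_subgroup_exists[OF fin q(1) subgroup_self] by blast
    then have sS: "subgroup S G" and cS: "card S = q ^ multiplicity q (order G)"
      by (auto simp: sylow_subgroup_def order_def)
    have "S \<subseteq> T <#> C"
    proof (cases "q = p")
      case True
      have "S = T"
        using sylow_conjugate[OF fin p subgroup_self T] S conj_set_normal[OF nT] True by auto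
      then show ?thesis using TC by simp
    next
      case False
      interpret S: normal S G using nilpotent_sylow_normal[OF fin nil q(1) S] .
      have sI: "subgroup (S \<inter> T) G" using subgroups_Inter_pair[OF sS T.is_subgroup] .
      have "card (S \<inter> T) dvd q ^ multiplicity q (order G)" "card (S \<inter> T) dvd p ^ multiplicity p (order G)"
        using card_subgroup_dvd[OF sI sS] card_subgroup_dvd[OF sI T.is_subgroup] cS T
        by (auto simp: sylow_subgroup_def order_def)
      moreover have "coprime (q ^ multiplicity q (order G)) (p ^ multiplicity p (order G))"
        using False p q by (simp add: primes_coprime)
      ultimately have "card (S \<inter> T) = 1" using coprime_common_divisor_nat by blast
      then have I: "S \<inter> T = {\<one>}" using subgroup.one_closed[OF sI] by (metis card_1_singletonE singletonD)
      have "s \<otimes> t = t \<otimes> s" if "s \<in> S" "t \<in> T" for s t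
        using normal_imp_commuting[OF S.normal_axioms nT _ that] I by simp
      then have "S \<subseteq> C" by (auto simp: C_def)
      then show ?thesis using TC by blast
    qed
    then show ?thesis using card_subgroup_dvd[OF sS D] cS by simp
  qed
  have "order G \<noteq> 0" using fin order_gt_0_iff_finite by simp
  from dvd_if_multiplicity_le[OF this q_part] have "order G dvd card (T <#> C)" .
  then have "order G \<le> card (T <#> C)"
    using card_subgroup_pos[OF fin D] by (rule dvd_imp_le)
  then have "T <#> C = carrier G"
    using subgroup.subset[OF D] fin unfolding order_def by (intro card_seteq)
  then have "g \<in> T <#> C" using g by simp
  then show ?thesis by (auto simp: set_mult_def C_def)
qed

lemma sylow_subgroup_subgroup_iff:
  assumes "subgroup Y G"
  shows "sylow_subgroup (G\<lparr>carrier := Y\<rparr>) p Y T \<longleftrightarrow> sylow_subgroup G p Y T"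
  using assms subgroup_incl[of T Y] incl_subgroup[of Y T] by (auto simp: sylow_subgroup_def)

text \<open>The form in which nilpotency of a maximal subgroup is used: both conclusions are read in
  the ambient group \<open>G\<close>.\<close>

lemma nilpotent_subgroup_sylow:
  assumes fin: "finite (carrier G)" and Y: "subgroup Y G" and nil: "nilpotent_group (G\<lparr>carrier := Y\<rparr>)"
    and p: "prime p" and T: "sylow_subgroup G p Y T"
  shows "Y \<subseteq> normalizer G T"
    and "y \<in> Y \<Longrightarrow> \<exists>t\<in>T. \<exists>c\<in>Y. y = t \<otimes> c \<and> (\<forall>s\<in>T. c \<otimes> s = s \<otimes> c)"
proof -
  interpret Y: group "G\<lparr>carrier := Y\<rparr>" using subgroup_imp_group[OF Y] .
  have finY: "finite (carrier (G\<lparr>carrier := Y\<rparr>))" using finite_subset[OF subgroup.subset[OF Y] fin] by simp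
  have T': "sylow_subgroup (G\<lparr>carrier := Y\<rparr>) p (carrier (G\<lparr>carrier := Y\<rparr>)) T"
    using T sylow_subgroup_subgroup_iff[OF Y] by simp
  have subT: "T \<subseteq> carrier G" using T Y subgroup.subset unfolding sylow_subgroup_def by blast
  show "Y \<subseteq> normalizer G T"
  proof
    fix y assume y: "y \<in> Y"
    then have "y \<in> carrier G" using subgroup.subset[OF Y] by blast
    moreover have "y \<otimes> t \<otimes> inv y \<in> T" if "t \<in> T" for t
      using Y.normal_invE(2)[OF Y.nilpotent_sylow_normal[OF finY nil p T'], of y t] that y
      by (simp add: m_inv_consistent[OF Y])
    ultimately show "y \<in> normalizer G T" using mem_normalizerI[OF fin subT] by blast
  qed
  show "\<exists>t\<in>T. \<exists>c\<in>Y. y = t \<otimes> c \<and> (\<forall>s\<in>T. c \<otimes> s = s \<otimes> c)" if "y \<in> Y"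
    using Y.nilpotent_eq_sylow_mult_centralizer[OF finY nil p T', of y] that by simp
qed

end

section \<open>Homomorphic images of nilpotent groups\<close>

lemma (in group_hom) lower_central_img:
  assumes "h ` carrier G = carrier H"
  shows "lower_central H n = h ` lower_central G n"
proof (induction n)
  case 0
  then show ?case using assms by simp
next
  case (Suc n)
  have sub: "{x \<otimes> y \<otimes> inv x \<otimes> inv y | x y. x \<in> lower_central G n \<and> y \<in> carrier G} \<subseteq> carrier G"
    using G.lower_central_subset[of n] by auto
  have "{x \<otimes>\<^bsub>H\<^esub> y \<otimes>\<^bsub>H\<^esub> inv\<^bsub>H\<^esub> x \<otimes>\<^bsub>H\<^esub> inv\<^bsub>H\<^esub> y | x y. x \<in> h ` lower_central G n \<and> y \<in> h ` carrier G}
      = {h x \<otimes>\<^bsub>H\<^esub> h y \<otimes>\<^bsub>H\<^esub> inv\<^bsub>H\<^esub> h x \<otimes>\<^bsub>H\<^esub> inv\<^bsub>H\<^esub> h y | x y. x \<in> lower_central G n \<and> y \<in> carrier G}"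
    by blast
  also have "\<dots> = {h (x \<otimes> y \<otimes> inv x \<otimes> inv y) | x y. x \<in> lower_central G n \<and> y \<in> carrier G}"
  proof -
    have "h x \<otimes>\<^bsub>H\<^esub> h y \<otimes>\<^bsub>H\<^esub> inv\<^bsub>H\<^esub> h x \<otimes>\<^bsub>H\<^esub> inv\<^bsub>H\<^esub> h y = h (x \<otimes> y \<otimes> inv x \<otimes> inv y)"
      if "x \<in> lower_central G n" "y \<in> carrier G" for x y
      using that G.lower_central_subset[of n] by (simp add: subset_iff)
    then show ?thesis by (intro Collect_cong) metis
  qed
  also have "\<dots> = h ` {x \<otimes> y \<otimes> inv x \<otimes> inv y | x y. x \<in> lower_central G n \<and> y \<in> carrier G}"
    by blast
  finally show ?case
    using Suc generate_img[OF sub] assms by simp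
qed

lemma (in group_hom) nilpotent_img:
  assumes M: "subgroup M G" and nil: "nilpotent_group (G\<lparr>carrier := M\<rparr>)"
  shows "nilpotent_group (H\<lparr>carrier := h ` M\<rparr>)"
proof -
  interpret r: group_hom "G\<lparr>carrier := M\<rparr>" "H\<lparr>carrier := h ` M\<rparr>" h
    using induced_group_hom[OF M] .
  obtain n where "lower_central (G\<lparr>carrier := M\<rparr>) n = {\<one>}"
    using nil by (auto simp: nilpotent_group_def)
  then show ?thesis
    using r.lower_central_img[of n] r.H.is_group by (auto simp: nilpotent_group_def intro!: exI[of _ n])
qed

section \<open>Transfer\<close>

text \<open>\<open>f\<close> extends \<open>\<phi>\<close> from \<open>P\<close> to a map on \<open>G\<close> with \<open>f (u g) = \<phi> u f g\<close> for \<open>u \<in> P\<close>;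
  the ratio \<open>f (c x) / f c\<close> then depends only on the coset \<open>P c\<close>, and its product over all
  cosets is the transfer of \<open>x\<close>. A coset outside \<open>M\<close> lies in a regular \<open>P\<close>-orbit, where the
  ratio is a coboundary and contributes nothing when \<open>x \<in> P\<close>.\<close>

lemma transfer_to_abelian_group:
  fixes G :: "('a, 'b) monoid_scheme" and A :: "('c, 'd) monoid_scheme" (structure)
  assumes "group G" and fin: "finite (carrier G)" and P: "subgroup P G" and M: "subgroup M G" "P \<subseteq> M"
    and A: "comm_group A" and \<phi>: "\<phi> \<in> hom (G\<lparr>carrier := P\<rparr>) A"
    and TI: "\<And>g u. g \<in> carrier G - M \<Longrightarrow> u \<in> P \<Longrightarrow> g \<otimes>\<^bsub>G\<^esub> u \<otimes>\<^bsub>G\<^esub> inv\<^bsub>G\<^esub> g \<in> P \<Longrightarrow> u = \<one>\<^bsub>G\<^esub>"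
    and nor: "\<And>g u. g \<in> M \<Longrightarrow> u \<in> P \<Longrightarrow> g \<otimes>\<^bsub>G\<^esub> u \<otimes>\<^bsub>G\<^esub> inv\<^bsub>G\<^esub> g \<in> P"
    and inv_phi: "\<And>g u. g \<in> M \<Longrightarrow> u \<in> P \<Longrightarrow> \<phi> (g \<otimes>\<^bsub>G\<^esub> u \<otimes>\<^bsub>G\<^esub> inv\<^bsub>G\<^esub> g) = \<phi> u"
  shows "\<exists>V \<in> hom G A. \<forall>x\<in>P. V x = \<phi> x [^] (card M div card P)"
proof -
  interpret group G by fact
  interpret A: comm_group A by fact
  interpret P: subgroup P G by fact
  interpret M: subgroup M G by fact
  have phi_closed: "\<phi> u \<in> carrier A" if "u \<in> P" for u
    using \<phi> that by (auto simp: hom_def)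
  have phi_mult: "\<phi> (u \<otimes>\<^bsub>G\<^esub> v) = \<phi> u \<otimes> \<phi> v" if "u \<in> P" "v \<in> P" for u v
    using \<phi> that by (auto simp: hom_def)
  \<comment> \<open>\<open>\<rho>\<close> picks one representative per right coset of
    \<open>P\<close>, and \<open>f\<close> measures through \<open>\<phi>\<close> how far
    \<open>g\<close> is from it.\<close>
  define \<rho> where "\<rho> C = (SOME c. c \<in> C)" for C :: "'a set"
  define f where "f g = \<phi> (g \<otimes>\<^bsub>G\<^esub> inv\<^bsub>G\<^esub> \<rho> (P #>\<^bsub>G\<^esub> g))" for g
  have rho: "\<exists>u\<in>P. \<rho> (P #>\<^bsub>G\<^esub> g) = u \<otimes>\<^bsub>G\<^esub> g" if "g \<in> carrier G" for g
  proof -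
    have "\<rho> (P #>\<^bsub>G\<^esub> g) \<in> P #>\<^bsub>G\<^esub> g"
      unfolding \<rho>_def using rcos_self[OF that P] by (rule someI)
    then show ?thesis by (auto simp: r_coset_def)
  qed
  have f_arg: "g \<otimes>\<^bsub>G\<^esub> inv\<^bsub>G\<^esub> \<rho> (P #>\<^bsub>G\<^esub> g) \<in> P" if "g \<in> carrier G" for g
    using rho[OF that] that by (auto simp: inv_mult_group)
  have rho_closed: "\<rho> (P #>\<^bsub>G\<^esub> g) \<in> carrier G" if "g \<in> carrier G" for g
    using rho[OF that] that by auto
  have f_closed: "f g \<in> carrier A" if "g \<in> carrier G" for g
    unfolding f_def using phi_closed f_arg[OF that] .
  have coset_absorb: "P #>\<^bsub>G\<^esub> (u \<otimes>\<^bsub>G\<^esub> g) = P #>\<^bsub>G\<^esub> g" if "u \<in> P" "g \<in> carrier G" for u g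
    using that coset_mult_assoc[OF P.subset, of u g] coset_join2[of u P] P by simp
  have f_mult: "f (u \<otimes>\<^bsub>G\<^esub> g) = \<phi> u \<otimes> f g" if "u \<in> P" "g \<in> carrier G" for u g
    using that f_arg rho_closed
    by (simp add: f_def coset_absorb m_assoc phi_mult[symmetric])
  define h where "h x C = f (\<rho> C \<otimes>\<^bsub>G\<^esub> x) \<otimes> inv f (\<rho> C)" for x C
  have h_eq: "h x (P #>\<^bsub>G\<^esub> c) = f (c \<otimes>\<^bsub>G\<^esub> x) \<otimes> inv f c" if "x \<in> carrier G" "c \<in> carrier G" for x c
  proof -
    obtain u where u: "u \<in> P" "\<rho> (P #>\<^bsub>G\<^esub> c) = u \<otimes>\<^bsub>G\<^esub> c" using rho \<open>c \<in> carrier G\<close> by blast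
    have "h x (P #>\<^bsub>G\<^esub> c) = (\<phi> u \<otimes> f (c \<otimes>\<^bsub>G\<^esub> x)) \<otimes> inv (\<phi> u \<otimes> f c)"
      using that u by (simp add: h_def m_assoc f_mult)
    also have "\<dots> = f (c \<otimes>\<^bsub>G\<^esub> x) \<otimes> inv f c"
    proof -
      have "\<phi> u \<in> carrier A" "f (c \<otimes>\<^bsub>G\<^esub> x) \<in> carrier A" "f c \<in> carrier A"
        using u that by (simp_all add: phi_closed f_closed)
      then show ?thesis
        by (simp add: A.inv_mult_group A.m_comm[of "\<phi> u"] A.m_assoc)
    qed
    finally show ?thesis .
  qed
  have rcos: "\<exists>c\<in>carrier G. C = P #>\<^bsub>G\<^esub> c" if "C \<in> rcosets\<^bsub>G\<^esub> P" for C
    using that by (auto simp: RCOSETS_def)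
  have h_closed: "h x C \<in> carrier A" if x: "x \<in> carrier G" and C: "C \<in> rcosets\<^bsub>G\<^esub> P" for x C
    using rcos[OF C] x by (auto simp: h_eq f_closed)
  have shift: "P #>\<^bsub>G\<^esub> c #>\<^bsub>G\<^esub> x = P #>\<^bsub>G\<^esub> (c \<otimes>\<^bsub>G\<^esub> x)" if "x \<in> carrier G" "c \<in> carrier G" for x c
    using that by (simp add: coset_mult_assoc P.subset)
  \<comment> \<open>Translation by \<open>x\<close> permutes the cosets, so multiplying this
    identity over all of them makes \<open>V\<close> multiplicative.\<close>
  have cocycle: "h (x \<otimes>\<^bsub>G\<^esub> y) C = h y (C #>\<^bsub>G\<^esub> x) \<otimes> h x C"
    if x: "x \<in> carrier G" and y: "y \<in> carrier G" and C: "C \<in> rcosets\<^bsub>G\<^esub> P" for x y C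
  proof -
    obtain c where c: "c \<in> carrier G" "C = P #>\<^bsub>G\<^esub> c" using rcos[OF C] by blast
    have "f (c \<otimes>\<^bsub>G\<^esub> x) \<in> carrier A" "f c \<in> carrier A" "f (c \<otimes>\<^bsub>G\<^esub> x \<otimes>\<^bsub>G\<^esub> y) \<in> carrier A"
      using x y c f_closed by simp_all
    then have "f (c \<otimes>\<^bsub>G\<^esub> x \<otimes>\<^bsub>G\<^esub> y) \<otimes> inv f (c \<otimes>\<^bsub>G\<^esub> x) \<otimes> (f (c \<otimes>\<^bsub>G\<^esub> x) \<otimes> inv f c)
        = f (c \<otimes>\<^bsub>G\<^esub> x \<otimes>\<^bsub>G\<^esub> y) \<otimes> inv f c"
      by (simp add: A.m_assoc)
    then show ?thesis using x y c by (simp add: h_eq shift m_assoc)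
  qed
  have shift_rcosets: "C #>\<^bsub>G\<^esub> x \<in> rcosets\<^bsub>G\<^esub> P" if x: "x \<in> carrier G" and C: "C \<in> rcosets\<^bsub>G\<^esub> P" for x C
    using rcos[OF C] x by (auto simp: shift rcosetsI P.subset)
  have shift_shift: "C #>\<^bsub>G\<^esub> x #>\<^bsub>G\<^esub> y = C #>\<^bsub>G\<^esub> (x \<otimes>\<^bsub>G\<^esub> y)"
    if x: "x \<in> carrier G" and y: "y \<in> carrier G" and C: "C \<in> rcosets\<^bsub>G\<^esub> P" for x y C
    using P.rcosets_carrier[OF is_group C] x y by (rule coset_mult_assoc)
  have shift_one: "C #>\<^bsub>G\<^esub> \<one>\<^bsub>G\<^esub> = C" if C: "C \<in> rcosets\<^bsub>G\<^esub> P" for C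
    using P.rcosets_carrier[OF is_group C] by simp
  have finR: "finite (rcosets\<^bsub>G\<^esub> P)" using fin by (simp add: RCOSETS_def)
  have inj_shift: "inj_on (\<lambda>C. C #>\<^bsub>G\<^esub> x) S" if x: "x \<in> carrier G" and S: "S \<subseteq> rcosets\<^bsub>G\<^esub> P" for x S
  proof (rule inj_onI)
    fix C D assume CD: "C \<in> S" "D \<in> S" "C #>\<^bsub>G\<^esub> x = D #>\<^bsub>G\<^esub> x"
    have cancel: "E #>\<^bsub>G\<^esub> x #>\<^bsub>G\<^esub> inv\<^bsub>G\<^esub> x = E" if "E \<in> S" for E
      using that x S by (simp add: shift_shift shift_one subset_iff)
    show "C = D" using cancel[OF CD(1)] unfolding CD(3) cancel[OF CD(2)] by (rule sym)
  qed
  have reindex: "(\<Otimes>C\<in>S. k (C #>\<^bsub>G\<^esub> x)) = (\<Otimes>C\<in>S. k C)"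
    if x: "x \<in> carrier G" and S: "S \<subseteq> rcosets\<^bsub>G\<^esub> P" and st: "\<And>C. C \<in> S \<Longrightarrow> C #>\<^bsub>G\<^esub> x \<in> S"
      and k: "k \<in> S \<rightarrow> carrier A" for x S k
  proof -
    have "(\<lambda>C. C #>\<^bsub>G\<^esub> x) ` S = S"
      using inj_shift[OF x S] st finite_subset[OF S finR] by (intro endo_inj_surj) auto
    then show ?thesis using A.finprod_reindex[of k "\<lambda>C. C #>\<^bsub>G\<^esub> x" S] k inj_shift[OF x S] by simp
  qed
  define V where "V x = (\<Otimes>C\<in>rcosets\<^bsub>G\<^esub> P. h x C)" for x
  have "V \<in> hom G A"
  proof (rule homI)
    show "V x \<in> carrier A" if "x \<in> carrier G" for x
      unfolding V_def using that h_closed by (intro A.finprod_closed) auto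
    show "V (x \<otimes>\<^bsub>G\<^esub> y) = V x \<otimes> V y" if xy: "x \<in> carrier G" "y \<in> carrier G" for x y
    proof -
      have "V (x \<otimes>\<^bsub>G\<^esub> y) = (\<Otimes>C\<in>rcosets\<^bsub>G\<^esub> P. h y (C #>\<^bsub>G\<^esub> x) \<otimes> h x C)"
        unfolding V_def using xy h_closed shift_rcosets by (intro A.finprod_cong') (auto simp: cocycle)
      also have "\<dots> = (\<Otimes>C\<in>rcosets\<^bsub>G\<^esub> P. h y (C #>\<^bsub>G\<^esub> x)) \<otimes> V x"
        unfolding V_def using xy h_closed shift_rcosets by (intro A.finprod_multf) auto
      also have "(\<Otimes>C\<in>rcosets\<^bsub>G\<^esub> P. h y (C #>\<^bsub>G\<^esub> x)) = V y"
        unfolding V_def using xy h_closed shift_rcosets by (intro reindex) auto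
      finally show ?thesis
        using xy h_closed by (simp add: V_def A.m_comm Pi_def)
    qed
  qed
  moreover have "V x = \<phi> x [^] (card M div card P)" if x: "x \<in> P" for x
  proof -
    have xc: "x \<in> carrier G" using x by auto
    define RM where "RM = (\<lambda>g. P #>\<^bsub>G\<^esub> g) ` M"
    define RN where "RN = (\<lambda>g. P #>\<^bsub>G\<^esub> g) ` (carrier G - M)"
    have sub: "RM \<subseteq> rcosets\<^bsub>G\<^esub> P" "RN \<subseteq> rcosets\<^bsub>G\<^esub> P"
      using M.subset by (auto simp: RM_def RN_def RCOSETS_def)
    have union: "rcosets\<^bsub>G\<^esub> P = RM \<union> RN"
      using M.subset by (auto simp: RM_def RN_def RCOSETS_def)
    have disj: "RM \<inter> RN = {}"
    proof -
      have "P #>\<^bsub>G\<^esub> m \<noteq> P #>\<^bsub>G\<^esub> g" if "m \<in> M" "g \<in> carrier G - M" for m g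
      proof
        assume "P #>\<^bsub>G\<^esub> m = P #>\<^bsub>G\<^esub> g"
        then have "g \<in> P #>\<^bsub>G\<^esub> m" using rcos_self[of g P] that P by auto
        then show False using that M(2) by (auto simp: r_coset_def)
      qed
      then show ?thesis by (auto simp: RM_def RN_def)
    qed
    \<comment> \<open>For \<open>g \<in> M\<close> one has \<open>g x = (g x g^-1) g\<close> with
      \<open>g x g^-1 \<in> P\<close>, so each coset inside \<open>M\<close> contributes
      \<open>\<phi> (g x g^-1) = \<phi> x\<close>.\<close>
    have "(\<Otimes>C\<in>RM. h x C) = (\<Otimes>C\<in>RM. \<phi> x)"
    proof (rule A.finprod_cong')
      show "h x C = \<phi> x" if "C \<in> RM" for C
      proof -
        obtain g where g: "g \<in> M" "C = P #>\<^bsub>G\<^esub> g" using \<open>C \<in> RM\<close> by (auto simp: RM_def)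
        have gc: "g \<in> carrier G" using g by auto
        have "g \<otimes>\<^bsub>G\<^esub> x = (g \<otimes>\<^bsub>G\<^esub> x \<otimes>\<^bsub>G\<^esub> inv\<^bsub>G\<^esub> g) \<otimes>\<^bsub>G\<^esub> g" using gc xc by (simp add: m_assoc)
        then have "f (g \<otimes>\<^bsub>G\<^esub> x) = \<phi> x \<otimes> f g"
          using f_mult[OF nor[OF g(1) x] gc] inv_phi[OF g(1) x] by simp
        then show ?thesis
          using g gc xc x by (simp add: h_eq f_closed phi_closed A.m_assoc)
      qed
    qed (use x in \<open>auto simp: phi_closed\<close>)
    also have "\<dots> = \<phi> x [^] card RM" using x by (simp add: A.finprod_const phi_closed)
    also have "card RM = card M div card P"
    proof -
      interpret GM: group "G\<lparr>carrier := M\<rparr>" using subgroup_imp_group[OF M(1)] .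
      have "rcosets\<^bsub>G\<lparr>carrier := M\<rparr>\<^esub> P = RM" by (auto simp: RCOSETS_def RM_def)
      then have "card RM * card P = card M"
        using GM.lagrange[OF subgroup_incl[OF P M(1) M(2)]] by (simp add: order_def)
      then show ?thesis using card_subgroup_pos[OF fin P] by (metis nonzero_mult_div_cancel_right less_not_refl)
    qed
    finally have prodM: "(\<Otimes>C\<in>RM. h x C) = \<phi> x [^] (card M div card P)" .
    have RN_shift: "C #>\<^bsub>G\<^esub> u \<in> RN" if "C \<in> RN" "u \<in> P" for C u
    proof -
      obtain g where g: "g \<in> carrier G" "g \<notin> M" "C = P #>\<^bsub>G\<^esub> g" using \<open>C \<in> RN\<close> by (auto simp: RN_def)
      have "g \<otimes>\<^bsub>G\<^esub> u \<notin> M"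
      proof
        assume "g \<otimes>\<^bsub>G\<^esub> u \<in> M"
        then have "g \<otimes>\<^bsub>G\<^esub> u \<otimes>\<^bsub>G\<^esub> inv\<^bsub>G\<^esub> u \<in> M"
          using \<open>u \<in> P\<close> M(2) by (intro M.m_closed[of "g \<otimes>\<^bsub>G\<^esub> u"] M.m_inv_closed) auto
        then show False using g that by (simp add: m_assoc)
      qed
      then show ?thesis using g that by (auto simp: RN_def shift)
    qed
    \<comment> \<open>If \<open>P g u = P g v\<close> with \<open>g\<close> outside
      \<open>M\<close>, then \<open>g\<close> conjugates \<open>u v^-1\<close> into
      \<open>P\<close>, so \<open>u = v\<close> by \<open>TI\<close>.\<close>
    have free: "u = v" if C: "C \<in> RN" and u: "u \<in> P" and v: "v \<in> P" and eq: "C #>\<^bsub>G\<^esub> u = C #>\<^bsub>G\<^esub> v" for C u v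
    proof -
      obtain g where g: "g \<in> carrier G - M" "C = P #>\<^bsub>G\<^esub> g" using C by (auto simp: RN_def)
      then have "g \<otimes>\<^bsub>G\<^esub> u \<in> P #>\<^bsub>G\<^esub> (g \<otimes>\<^bsub>G\<^esub> v)"
        using eq u v rcos_self[of "g \<otimes>\<^bsub>G\<^esub> u" P] P by (simp add: shift)
      then have "g \<otimes>\<^bsub>G\<^esub> u \<otimes>\<^bsub>G\<^esub> inv\<^bsub>G\<^esub> (g \<otimes>\<^bsub>G\<^esub> v) \<in> P"
        using P.rcos_module_imp[OF is_group, of "g \<otimes>\<^bsub>G\<^esub> v"] g v by simp
      then have "g \<otimes>\<^bsub>G\<^esub> (u \<otimes>\<^bsub>G\<^esub> inv\<^bsub>G\<^esub> v) \<otimes>\<^bsub>G\<^esub> inv\<^bsub>G\<^esub> g \<in> P"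
        using g u v by (simp add: inv_mult_group m_assoc)
      then have "u \<otimes>\<^bsub>G\<^esub> inv\<^bsub>G\<^esub> v = \<one>\<^bsub>G\<^esub>" using TI[OF g(1)] u v by simp
      then show ?thesis using u v inv_equality[of u "inv\<^bsub>G\<^esub> v"] by simp
    qed
    \<comment> \<open>\<open>r C\<close> is a base point depending only on the
      \<open>P\<close>-orbit of \<open>C\<close>, and \<open>w C\<close> is the element of
      \<open>P\<close> moving it to \<open>C\<close>, unique by \<open>free\<close>. With
      \<open>k C = h (w C) (r C)\<close>, the cocycle identity makes \<open>h x C\<close> the ratio
      of \<open>k (C #> x)\<close> to \<open>k C\<close>.\<close>
    define orb where "orb C = (\<lambda>u. C #>\<^bsub>G\<^esub> u) ` P" for C
    define r where "r C = (SOME D. D \<in> orb C)" for C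
    define w where "w C = (SOME u. u \<in> P \<and> r C #>\<^bsub>G\<^esub> u = C)" for C
    define k where "k C = h (w C) (r C)" for C
    have r: "\<exists>u\<in>P. r C = C #>\<^bsub>G\<^esub> u" for C
    proof -
      have "\<exists>D. D \<in> orb C" unfolding orb_def using P.one_closed by blast
      then have "r C \<in> orb C" unfolding r_def by (rule someI_ex)
      then show ?thesis by (auto simp: orb_def)
    qed
    have r_RN: "r C \<in> RN" if "C \<in> RN" for C
      using r[of C] RN_shift[OF that] by auto
    have w: "w C \<in> P \<and> r C #>\<^bsub>G\<^esub> w C = C" if "C \<in> RN" for C
    proof -
      obtain u where u: "u \<in> P" "r C = C #>\<^bsub>G\<^esub> u" using r by blast
      then have "r C #>\<^bsub>G\<^esub> inv\<^bsub>G\<^esub> u = C"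
        using that sub by (simp add: shift_shift shift_one subset_iff)
      then have "\<exists>u. u \<in> P \<and> r C #>\<^bsub>G\<^esub> u = C" using u by (intro exI[of _ "inv\<^bsub>G\<^esub> u"]) simp
      then show ?thesis unfolding w_def by (rule someI_ex)
    qed
    have k_closed: "k \<in> RN \<rightarrow> carrier A"
    proof
      fix C assume "C \<in> RN"
      then have "w C \<in> carrier G" "r C \<in> rcosets\<^bsub>G\<^esub> P" using w r_RN sub by auto
      then show "k C \<in> carrier A" unfolding k_def by (rule h_closed)
    qed
    have k_shift: "k (C #>\<^bsub>G\<^esub> x) = h x C \<otimes> k C" if C: "C \<in> RN" for C
    proof -
      have CR: "C \<in> rcosets\<^bsub>G\<^esub> P" using C sub by auto
      have "orb (C #>\<^bsub>G\<^esub> x) = orb C"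
      proof
        show "orb (C #>\<^bsub>G\<^esub> x) \<subseteq> orb C"
          using CR x by (auto simp: orb_def shift_shift)
        show "orb C \<subseteq> orb (C #>\<^bsub>G\<^esub> x)"
        proof
          fix D assume "D \<in> orb C"
          then obtain u where u: "u \<in> P" "D = C #>\<^bsub>G\<^esub> u" by (auto simp: orb_def)
          then have "D = C #>\<^bsub>G\<^esub> x #>\<^bsub>G\<^esub> (inv\<^bsub>G\<^esub> x \<otimes>\<^bsub>G\<^esub> u)" using CR x by (simp add: shift_shift)
          then show "D \<in> orb (C #>\<^bsub>G\<^esub> x)" using u x by (auto simp: orb_def)
        qed
      qed
      then have rx: "r (C #>\<^bsub>G\<^esub> x) = r C" by (simp add: r_def)
      have wC: "w C \<in> P" "r C #>\<^bsub>G\<^esub> w C = C" using w[OF C] by auto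
      have rR: "r C \<in> rcosets\<^bsub>G\<^esub> P" using r_RN[OF C] sub by auto
      have "r C #>\<^bsub>G\<^esub> w (C #>\<^bsub>G\<^esub> x) = C #>\<^bsub>G\<^esub> x" "w (C #>\<^bsub>G\<^esub> x) \<in> P"
        using w[OF RN_shift[OF C x]] rx by auto
      moreover have "r C #>\<^bsub>G\<^esub> (w C \<otimes>\<^bsub>G\<^esub> x) = C #>\<^bsub>G\<^esub> x"
        using shift_shift[OF _ xc rR, of "w C"] wC by simp
      ultimately have "w (C #>\<^bsub>G\<^esub> x) = w C \<otimes>\<^bsub>G\<^esub> x"
        using free[OF r_RN[OF C]] wC x by simp
      then show ?thesis using cocycle[OF _ xc rR, of "w C"] wC rx by (simp add: k_def)
    qed
    have hN: "(\<lambda>C. h x C) \<in> RN \<rightarrow> carrier A" using sub h_closed xc by auto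
    have "(\<Otimes>C\<in>RN. h x C) \<otimes> (\<Otimes>C\<in>RN. k C) = (\<Otimes>C\<in>RN. h x C \<otimes> k C)"
      using hN k_closed by simp
    also have "\<dots> = (\<Otimes>C\<in>RN. k (C #>\<^bsub>G\<^esub> x))"
      using k_shift k_closed RN_shift x by (intro A.finprod_cong') auto
    also have "\<dots> = (\<Otimes>C\<in>RN. k C)"
      using RN_shift x by (intro reindex[OF xc sub(2) _ k_closed]) auto
    finally have "(\<Otimes>C\<in>RN. h x C) = \<one>"
      using hN k_closed A.r_cancel_one by (metis A.finprod_closed)
    moreover have "V x = (\<Otimes>C\<in>RM. h x C) \<otimes> (\<Otimes>C\<in>RN. h x C)"
      unfolding V_def union using disj finite_subset[OF sub(1) finR] finite_subset[OF sub(2) finR]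
        hN sub h_closed xc by (intro A.finprod_Un_disjoint) auto
    ultimately show ?thesis using prodM phi_closed[OF x] by simp
  qed
  ultimately show ?thesis by blast
qed

section \<open>Minimal normal subgroups\<close>

context group
begin

lemma exists_maximal_subgroup:
  assumes fin: "finite (carrier G)" and X: "subgroup X G" "X \<noteq> carrier G"
  shows "\<exists>Y. maximal_subgroup Y G \<and> X \<subseteq> Y"
proof -
  define F where "F = {Y. subgroup Y G \<and> Y \<noteq> carrier G \<and> X \<subseteq> Y}"
  have "finite F"
    using fin subgroup.subset by (intro finite_subset[of F "Pow (carrier G)"]) (auto simp: F_def)
  moreover have "X \<in> F" using X by (simp add: F_def)
  ultimately obtain Y where Y: "Y \<in> F" "\<And>Z. Z \<in> F \<Longrightarrow> Y \<subseteq> Z \<Longrightarrow> Y = Z"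
    using finite_has_maximal[of F] by blast
  have "maximal_subgroup Y G"
    unfolding maximal_subgroup_def
  proof (intro conjI allI impI)
    fix K assume "subgroup K G \<and> Y \<subseteq> K"
    then show "K = Y \<or> K = carrier G" using Y(1) Y(2)[of K] by (auto simp: F_def)
  qed (use Y(1) in \<open>auto simp: F_def\<close>)
  then show ?thesis using Y(1) by (auto simp: F_def)
qed

text \<open>\<open>T\<close> is a Sylow subgroup of its own normalizer, so \<open>Q\<close> lies in
  a conjugate of \<open>T\<close> by a normalizing element, which is \<open>T\<close>
  itself.\<close>

lemma p_subgroup_of_sylow_normalizer:
  assumes fin: "finite (carrier G)" and p: "prime p" and T: "sylow_subgroup G p (carrier G) T"
    and Q: "subgroup Q G" "card Q = p ^ b" "Q \<subseteq> normalizer G T"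
  shows "Q \<subseteq> T"
proof -
  have sT: "subgroup T G" using T by (simp add: sylow_subgroup_def)
  have subT: "T \<subseteq> carrier G" using sT by (rule subgroup.subset)
  have sN: "subgroup (normalizer G T) G" using normalizer_subgroup[OF subT] .
  have "sylow_subgroup G p (normalizer G T) T"
    using sylow_subgroup_mono[OF fin p sN subgroup_self T subgroup_le_normalizer[OF sT] subgroup.subset[OF sN]] .
  from sylow_contains_conj[OF fin p sN this Q(1,3,2)]
  obtain n where "n \<in> normalizer G T" "Q \<subseteq> conj_set G n T" by blast
  then show ?thesis using subT by (simp add: normalizer_eq)
qed

end

text \<open>The case without nontrivial normal \<open>p\<close>-subgroups: \<open>no_p_core\<close>
  says that the largest normal \<open>p\<close>-subgroup is trivial, and \<open>L\<close> is a
  minimal normal subgroup. The aims are that \<open>p\<close> divides the index of \<open>L\<close>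
  and that \<open>card L\<close> is then a prime power.\<close>

locale minimal_normal_no_p_core = group G for G (structure) +
  fixes p :: nat and L
  assumes fin: "finite (carrier G)" and prime_p: "prime p" and p_dvd: "p dvd order G"
    and max_cases: "\<And>H. maximal_subgroup H G \<Longrightarrow> p dvd card H \<Longrightarrow>
      nilpotent_group (G\<lparr>carrier := H\<rparr>) \<or> H \<lhd> G"
    and no_p_core: "\<And>R a. R \<lhd> G \<Longrightarrow> card R = p ^ a \<Longrightarrow> R = {\<one>}"
    and L_normal: "L \<lhd> G" and L_nontriv: "L \<noteq> {\<one>}"
    and L_min: "\<And>N. N \<lhd> G \<Longrightarrow> N \<subseteq> L \<Longrightarrow> N \<noteq> {\<one>} \<Longrightarrow> N = L"
begin

sublocale L: normal L G by (rule L_normal)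

lemma normalizer_p_subgroup_neq:
  assumes "subgroup T G" "card T = p ^ a" "T \<noteq> {\<one>}"
  shows "normalizer G T \<noteq> carrier G"
  using normalizer_eq_carrier_imp_normal[OF assms(1)] no_p_core assms by blast

lemma sylow_nontrivial:
  assumes "subgroup K G" "sylow_subgroup G q K S" "prime q" "q dvd card K"
  shows "q dvd card S" "S \<noteq> {\<one>}"
proof -
  have "0 < multiplicity q (card K)"
    using assms(3,4) card_subgroup_pos[OF fin assms(1)] by (simp add: prime_multiplicity_gt_zero_iff)
  then show "q dvd card S" using assms(2) by (simp add: sylow_subgroup_def dvd_power)
  then show "S \<noteq> {\<one>}" using assms(3) not_prime_unit[of q] by auto
qed

text \<open>A maximal \<open>Y\<close> above \<open>X\<close> is not normal: otherwise
  \<open>Y \<inter> L\<close>, being nontrivial, would be \<open>L\<close>, and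
  \<open>L <#> X\<close> would lie in \<open>Y\<close>. So \<open>Y\<close> is nilpotent and
  normalizes its Sylow \<open>p\<close>-subgroup \<open>T\<close>. The normalizer of
  \<open>T\<close> is proper, hence equals \<open>Y\<close> by maximality, and \<open>T\<close>,
  being Sylow in its own normalizer, is Sylow in \<open>G\<close>.\<close>

lemma supplement_le_sylow_normalizer:
  assumes X: "subgroup X G" "X \<noteq> carrier G" and sup: "L <#> X = carrier G"
    and meet: "X \<inter> L \<noteq> {\<one>}" and dvd: "p dvd card X"
  shows "\<exists>T. sylow_subgroup G p (carrier G) T \<and> X \<subseteq> normalizer G T \<and>
    normalizer G T \<noteq> carrier G \<and> nilpotent_group (G\<lparr>carrier := normalizer G T\<rparr>)"
proof -
  obtain Y where Y: "maximal_subgroup Y G" "X \<subseteq> Y"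
    using exists_maximal_subgroup[OF fin X] by blast
  then have sY: "subgroup Y G" and Yne: "Y \<noteq> carrier G"
    by (auto simp: maximal_subgroup_def)
  have "\<not> Y \<lhd> G"
  proof
    assume "Y \<lhd> G"
    then have "Y \<inter> L \<lhd> G" using normal_subgroup_intersect L_normal by blast
    moreover have "Y \<inter> L \<noteq> {\<one>}"
      using meet Y(2) subgroup.one_closed[OF X(1)] L.one_closed by auto
    ultimately have "L \<subseteq> Y" using L_min[of "Y \<inter> L"] by blast
    then have "L <#> X \<subseteq> Y"
      using Y(2) subgroup.m_closed[OF sY] by (auto simp: set_mult_def)
    then show False using sup Yne subgroup.subset[OF sY] by auto
  qed
  moreover have pY: "p dvd card Y" using card_subgroup_dvd[OF X(1) sY Y(2)] dvd by (rule dvd_trans[rotated])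
  ultimately have nil: "nilpotent_group (G\<lparr>carrier := Y\<rparr>)" using max_cases[OF Y(1)] by blast
  obtain T where T: "sylow_subgroup G p Y T"
    using sylow_subgroup_exists[OF fin prime_p sY] by blast
  then have sT: "subgroup T G" and cT: "card T = p ^ multiplicity p (card Y)"
    by (auto simp: sylow_subgroup_def)
  have N: "subgroup (normalizer G T) G" using normalizer_subgroup[OF subgroup.subset[OF sT]] .
  have Nne: "normalizer G T \<noteq> carrier G"
    using normalizer_p_subgroup_neq[OF sT cT] sylow_nontrivial(2)[OF sY T prime_p pY] by blast
  have "Y \<subseteq> normalizer G T" using nilpotent_subgroup_sylow(1)[OF fin sY nil prime_p T] .
  then have NY: "normalizer G T = Y" using Y(1) N Nne by (auto simp: maximal_subgroup_def)
  have "sylow_subgroup G p (carrier G) T"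
    using sylow_in_normalizer_imp_sylow[OF fin prime_p] T NY by simp
  then show ?thesis using NY Y(2) Nne nil by auto
qed

lemma prime_power_if_p_dvd_index:
  assumes idx: "p dvd order G div card L"
  shows "\<exists>q a. prime q \<and> card L = q ^ a"
proof (rule ccontr)
  assume neg: "\<not> ?thesis"
  have ordL: "order G = (order G div card L) * card L"
    using lagrange[OF L.is_subgroup] by (metis dvd_div_mult_self dvd_triv_right)
  have posL: "0 < card L" using card_subgroup_pos[OF fin L.is_subgroup] .
  obtain P where P: "sylow_subgroup G p (carrier G) P"
    using sylow_subgroup_exists[OF fin prime_p subgroup_self] by blast
  define N where "N = normalizer G P"
  have subP: "P \<subseteq> carrier G" using P by (simp add: sylow_subgroup_def)
  have N: "subgroup N G" using normalizer_subgroup[OF subP] by (simp add: N_def)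
  have sN: "N \<subseteq> carrier G" using N by (rule subgroup.subset)
  have NL: "subgroup (N \<inter> L) G" using subgroups_Inter_pair[OF N L.is_subgroup] .
  have main: "\<exists>S g. sylow_subgroup G q L S \<and> g \<in> carrier G \<and> conj_set G g N \<noteq> carrier G
      \<and> normalizer G S \<subseteq> conj_set G g N" if q: "prime q" "q dvd card L" for q
  proof -
    obtain S where S: "sylow_subgroup G q L S"
      using sylow_subgroup_exists[OF fin q(1) L.is_subgroup] by blast
    have sS: "subgroup S G" "S \<subseteq> L" and cS: "card S = q ^ multiplicity q (card L)"
      using S by (auto simp: sylow_subgroup_def)
    have Snt: "S \<noteq> {\<one>}" using sylow_nontrivial(2)[OF L.is_subgroup S q] .
    have NSne: "normalizer G S \<noteq> carrier G"
    proof
      assume "normalizer G S = carrier G"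
      then have "S = L" using L_min normalizer_eq_carrier_imp_normal[OF sS(1)] sS(2) Snt by blast
      then show False using neg cS q(1) by blast
    qed
    have sNS: "subgroup (normalizer G S) G"
      using normalizer_subgroup[OF subgroup.subset[OF sS(1)]] .
    have fr: "L <#> normalizer G S = carrier G" using frattini[OF fin q(1) L_normal S] .
    have "S \<subseteq> normalizer G S \<inter> L" using sS subgroup_le_normalizer by auto
    then have meet: "normalizer G S \<inter> L \<noteq> {\<one>}" using Snt subgroup.one_closed[OF sS(1)] by auto
    \<comment> \<open>As \<open>L <#> normalizer G S\<close> is \<open>G\<close>, the order of the
      normalizer is the index of \<open>L\<close> times the order of its intersection with
      \<open>L\<close>; \<open>p\<close> divides the first factor.\<close>
    have pNS: "p dvd card (normalizer G S)"
    proof -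
      have "(order G div card L) * card L * card (L \<inter> normalizer G S) = card L * card (normalizer G S)"
        using card_set_mult[OF fin L.is_subgroup sNS] fr ordL by (simp add: order_def)
      then have "card L * ((order G div card L) * card (L \<inter> normalizer G S)) = card L * card (normalizer G S)"
        by (simp only: ac_simps)
      then have "(order G div card L) * card (L \<inter> normalizer G S) = card (normalizer G S)"
        using posL by simp
      then show ?thesis using idx by (metis dvd_mult2)
    qed
    obtain T where T: "sylow_subgroup G p (carrier G) T" "normalizer G S \<subseteq> normalizer G T"
      "normalizer G T \<noteq> carrier G"
      using supplement_le_sylow_normalizer[OF sNS NSne fr meet pNS] by blast
    obtain g where g: "g \<in> carrier G" "T = conj_set G g P"
      using sylow_conjugate[OF fin prime_p subgroup_self P T(1)] by blast
    then have "normalizer G T = conj_set G g N"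
      using normalizer_conj_set[OF subP] by (simp add: N_def)
    then show ?thesis using S g(1) T(2,3) by metis
  qed
  \<comment> \<open>Conjugating \<open>S\<close> back by \<open>inv g\<close> moves it into
    \<open>N\<close> and keeps it in the normal subgroup \<open>L\<close>; so
    \<open>N \<inter> L\<close> contains a Sylow \<open>q\<close>-subgroup of \<open>L\<close> for
    each \<open>q\<close>.\<close>
  have q_part: "q ^ multiplicity q (card L) dvd card (N \<inter> L)" if q: "prime q" "q dvd card L" for q
  proof -
    obtain S g where S: "sylow_subgroup G q L S" and g: "g \<in> carrier G" and le: "normalizer G S \<subseteq> conj_set G g N"
      using main[OF q] by blast
    have sS: "subgroup S G" "S \<subseteq> L" and cS: "card S = q ^ multiplicity q (card L)"
      using S by (auto simp: sylow_subgroup_def)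
    have subS: "S \<subseteq> carrier G" using sS(1) by (rule subgroup.subset)
    have "conj_set G (inv g) S \<subseteq> N"
      using le subgroup_le_normalizer[OF sS(1)] conj_set_subset_iff[OF subS sN g] by blast
    moreover have "conj_set G (inv g) S \<subseteq> L"
      using conj_set_mono[OF sS(2), of "inv g"] conj_set_normal[OF L_normal, of "inv g"] g by simp
    ultimately have "card (conj_set G (inv g) S) dvd card (N \<inter> L)"
      using card_subgroup_dvd[OF subgroup_conj_set[OF sS(1), of "inv g"] NL] g by simp
    then show ?thesis using card_conj_set[OF subS, of "inv g"] g cS by simp
  qed
  have "card L dvd card (N \<inter> L)" by (rule dvd_if_multiplicity_le) (use posL q_part in auto)
  then have "card L \<le> card (N \<inter> L)" using card_subgroup_pos[OF fin NL] by (rule dvd_imp_le)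
  then have LN: "L \<subseteq> N" using card_seteq[of L "N \<inter> L"] finite_subset[OF L.subset fin] by auto
  have "card L \<noteq> 1" using L_nontriv L.one_closed by (metis card_1_singletonE singletonD)
  then obtain q where q: "prime q" "q dvd card L" using prime_factor_nat by blast
  obtain S g where S: "sylow_subgroup G q L S" and g: "g \<in> carrier G" "conj_set G g N \<noteq> carrier G"
    and le: "normalizer G S \<subseteq> conj_set G g N" using main[OF q] by blast
  \<comment> \<open>Being normal, \<open>L\<close> lies in every conjugate of \<open>N\<close>. This
    proper conjugate also contains \<open>normalizer G S\<close>, hence all of
    \<open>L <#> normalizer G S = carrier G\<close>.\<close>
  have "L \<subseteq> conj_set G g N"
    using conj_set_mono[OF LN, of g] conj_set_normal[OF L_normal g(1)] by simp
  then have "L <#> normalizer G S \<subseteq> conj_set G g N"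
    using le subgroup.m_closed[OF subgroup_conj_set[OF N g(1)]] by (auto simp: set_mult_def)
  then show False
    using frattini[OF fin q(1) L_normal S] g conj_set_subset[OF sN g(1)] by auto
qed

lemma p_dvd_index: "p dvd order G div card L"
proof (rule ccontr)
  assume idx: "\<not> p dvd order G div card L"
  have ordL: "order G = (order G div card L) * card L"
    using lagrange[OF L.is_subgroup] by (metis dvd_div_mult_self dvd_triv_right)
  have posL: "0 < card L" using card_subgroup_pos[OF fin L.is_subgroup] .
  have pL: "p dvd card L" using p_dvd ordL idx prime_p by (metis prime_dvd_mult_iff)
  obtain P where PL: "sylow_subgroup G p L P"
    using sylow_subgroup_exists[OF fin prime_p L.is_subgroup] by blast
  have sP: "subgroup P G" and PsL: "P \<subseteq> L" and cP: "card P = p ^ multiplicity p (card L)"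
    using PL by (auto simp: sylow_subgroup_def)
  have subP: "P \<subseteq> carrier G" using sP by (rule subgroup.subset)
  have Pnt: "P \<noteq> {\<one>}" and pP: "p dvd card P"
    using sylow_nontrivial[OF L.is_subgroup PL prime_p pL] by auto
  \<comment> \<open>The index is prime to \<open>p\<close>, so \<open>L\<close> and \<open>G\<close>
    have the same \<open>p\<close>-part, and a Sylow subgroup of \<open>L\<close> is one of
    \<open>G\<close>.\<close>
  have "order G div card L \<noteq> 0" using idx by (metis dvd_0_right)
  then have "multiplicity p ((order G div card L) * card L)
      = multiplicity p (order G div card L) + multiplicity p (card L)"
    using prime_p posL by (intro prime_elem_multiplicity_mult_distrib) auto
  then have "multiplicity p (order G) = multiplicity p (card L)"
    using idx ordL by (simp add: not_dvd_imp_multiplicity_0)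
  then have P: "sylow_subgroup G p (carrier G) P"
    using sP cP subP by (simp add: sylow_subgroup_def order_def)
  define M where "M = normalizer G P"
  have M: "subgroup M G" "P \<subseteq> M"
    using normalizer_subgroup[OF subP] subgroup_le_normalizer[OF sP] by (auto simp: M_def)
  have subM: "M \<subseteq> carrier G" using M(1) by (rule subgroup.subset)
  have LMG: "L <#> M = carrier G" using frattini[OF fin prime_p L_normal PL] by (simp add: M_def)
  have Mne: "M \<noteq> carrier G" using normalizer_p_subgroup_neq[OF sP cP Pnt] by (simp add: M_def)
  have PsylM: "sylow_subgroup G p M P" using sylow_subgroup_mono[OF fin prime_p M(1) subgroup_self P M(2) subM] .
  have MmeetL: "M \<inter> L \<noteq> {\<one>}" using M(2) PsL Pnt subgroup.one_closed[OF sP] by auto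
  have pM: "p dvd card M" using card_subgroup_dvd[OF sP M] pP by (rule dvd_trans[rotated])
  \<comment> \<open>The supplement lemma places \<open>M\<close> in a nilpotent normalizer of some
    Sylow subgroup \<open>T\<close>; since \<open>P\<close> lies in it, \<open>P = T\<close> and
    that normalizer is \<open>M\<close>.\<close>
  have nilM: "nilpotent_group (G\<lparr>carrier := M\<rparr>)"
  proof -
    obtain T where T: "sylow_subgroup G p (carrier G) T" "M \<subseteq> normalizer G T"
      "nilpotent_group (G\<lparr>carrier := normalizer G T\<rparr>)"
      using supplement_le_sylow_normalizer[OF M(1) Mne LMG MmeetL pM] by blast
    have "P \<subseteq> T" using p_subgroup_of_sylow_normalizer[OF fin prime_p T(1) sP cP] M(2) T(2) by auto
    moreover have "card P = card T" "finite T"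
      using P T(1) fin finite_subset by (auto simp: sylow_subgroup_def)
    ultimately have "P = T" by (simp add: card_subset_eq)
    then show ?thesis using T(3) by (simp add: M_def)
  qed
  have M_split: "\<exists>t\<in>P. \<exists>c\<in>M. m = t \<otimes> c \<and> (\<forall>s\<in>P. c \<otimes> s = s \<otimes> c)" if "m \<in> M" for m
    using nilpotent_subgroup_sylow(2)[OF fin M(1) nilM prime_p PsylM that] .
  have local_sylow: "\<exists>T. sylow_subgroup G p (carrier G) T \<and> normalizer G H \<subseteq> normalizer G T"
    if H: "subgroup H G" "H \<subseteq> P" "H \<noteq> {\<one>}" for H
  proof -
    have subH: "H \<subseteq> carrier G" using H(1) by (rule subgroup.subset)
    have N: "subgroup (normalizer G H) G" using normalizer_subgroup[OF subH] .
    obtain b where b: "card H = p ^ b"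
      using card_subgroup_dvd[OF H(1) sP H(2)] cP prime_p by (auto simp: divides_primepow_nat)
    have HN: "H \<subseteq> normalizer G H" using subgroup_le_normalizer[OF H(1)] .
    have "b \<noteq> 0"
    proof
      assume "b = 0"
      then show False using b H(3) subgroup.one_closed[OF H(1)] by (auto simp: card_1_singleton_iff)
    qed
    then have "p dvd card H" using b by (simp add: dvd_power)
    then have pN: "p dvd card (normalizer G H)"
      using card_subgroup_dvd[OF H(1) N HN] by (rule dvd_trans)
    \<comment> \<open>Write \<open>g = l t c\<close> with \<open>l \<in> L\<close>,
      \<open>t \<in> P\<close> and \<open>c\<close> centralizing \<open>P\<close>: then
      \<open>l t \<in> L\<close>, and \<open>c\<close> normalizes every subgroup of
      \<open>P\<close>, in particular \<open>H\<close>.\<close>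
    have "carrier G \<subseteq> L <#> normalizer G H"
    proof
      fix g assume "g \<in> carrier G"
      then have "g \<in> L <#> M" using LMG by simp
      then obtain l m where lm: "l \<in> L" "m \<in> M" "g = l \<otimes> m" by (auto simp: set_mult_def)
      obtain t c where tc: "t \<in> P" "c \<in> M" "m = t \<otimes> c" "\<forall>s\<in>P. c \<otimes> s = s \<otimes> c"
        using M_split[OF lm(2)] by blast
      have cc: "c \<in> carrier G" "t \<in> carrier G" "l \<in> carrier G" using tc subM subP lm by auto
      have "c \<otimes> s \<otimes> inv c \<in> H" if "s \<in> H" for s
      proof -
        have "c \<otimes> s = s \<otimes> c" "s \<in> carrier G" using tc(4) H(2) subH that by auto
        then show ?thesis using that cc by (simp add: m_assoc)
      qed
      then have "c \<in> normalizer G H" using mem_normalizerI[OF fin subH cc(1)] by blast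
      moreover have "l \<otimes> t \<in> L" using lm(1) tc(1) PsL by auto
      moreover have "g = (l \<otimes> t) \<otimes> c" using lm(3) tc(3) cc by (simp add: m_assoc)
      ultimately show "g \<in> L <#> normalizer G H" unfolding set_mult_def by blast
    qed
    then have sup: "L <#> normalizer G H = carrier G"
      using set_mult_closed[OF L.subset subgroup.subset[OF N]] by blast
    have meet: "normalizer G H \<inter> L \<noteq> {\<one>}"
      using HN H PsL subgroup.one_closed[OF H(1)] by auto
    show ?thesis
      using supplement_le_sylow_normalizer[OF N normalizer_p_subgroup_neq[OF H(1) b H(3)] sup meet pN]
      by blast
  qed
  have card_sylow: "card Q = card P \<and> finite Q \<and> subgroup Q G" if "sylow_subgroup G p (carrier G) Q" for Q
    using that P fin finite_subset by (auto simp: sylow_subgroup_def)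
  \<comment> \<open>Downward induction on the order of \<open>H = P \<inter> Q\<close>. The
    normalizer of \<open>H\<close> lies in that of some Sylow subgroup \<open>T\<close>, so the
    elements of \<open>P\<close> and of \<open>Q\<close> normalizing \<open>H\<close> lie in
    \<open>T\<close>. Growth in \<open>P\<close> makes \<open>P \<inter> T\<close> larger than
    \<open>H\<close>, so \<open>T = P\<close> by induction; growth in \<open>Q\<close> then yields
    an element of \<open>P \<inter> Q\<close> outside \<open>H\<close>.\<close>
  have TI: "Q = P" if "sylow_subgroup G p (carrier G) Q" "P \<inter> Q \<noteq> {\<one>}" for Q
    using that
  proof (induction "card P - card (P \<inter> Q)" arbitrary: Q rule: less_induct)
    case less
    show ?case
    proof (rule ccontr)
      assume ne: "Q \<noteq> P"
      define H where "H = P \<inter> Q"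
      have Q: "subgroup Q G" "card Q = card P" "finite Q" using card_sylow[OF less(2)] by auto
      have finP: "finite P" using card_sylow[OF P] by auto
      have "\<not> P \<subseteq> Q" "\<not> Q \<subseteq> P"
        using ne Q finP card_subset_eq[of Q P] card_subset_eq[of P Q] by auto
      then have H: "H \<subset> P" "H \<subset> Q" by (auto simp: H_def)
      have sH: "subgroup H G" using subgroups_Inter_pair[OF sP Q(1)] by (simp add: H_def)
      obtain T where T: "sylow_subgroup G p (carrier G) T" "normalizer G H \<subseteq> normalizer G T"
        using local_sylow[OF sH] H(1) less(3) by (auto simp: H_def)
      have inT: "R \<inter> normalizer G H \<subseteq> T" if R: "subgroup R G" "card R = card P" for R
      proof -
        have s: "subgroup (R \<inter> normalizer G H) G"
          using subgroups_Inter_pair[OF R(1) normalizer_subgroup[OF subgroup.subset[OF sH]]] .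
        obtain b where "card (R \<inter> normalizer G H) = p ^ b"
          using card_subgroup_dvd[OF s R(1)] R(2) cP prime_p by (auto simp: divides_primepow_nat)
        from p_subgroup_of_sylow_normalizer[OF fin prime_p T(1) s this] show ?thesis using T(2) by auto
      qed
      obtain x where x: "x \<in> P" "x \<notin> H" "x \<in> normalizer G H"
        using p_subgroup_normalizer_grows[OF fin prime_p sP cP sH H(1)] by auto
      have "H \<subseteq> P \<inter> T" using inT[OF sP refl] subgroup_le_normalizer[OF sH] H(1) by auto
      moreover have xT: "x \<in> P \<inter> T" using inT[OF sP refl] x by auto
      ultimately have "H \<subset> P \<inter> T" using x(2) by auto
      then have "card H < card (P \<inter> T)"
        using finP psubset_card_mono[of "P \<inter> T" H] by simp
      moreover have "P \<inter> T \<noteq> {\<one>}"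
        using xT x(2) subgroup.one_closed[OF sH] by (metis singletonD)
      moreover have "card (P \<inter> T) \<le> card P" using finP by (simp add: card_mono)
      ultimately have "T = P" using less(1)[of T] T(1) by (simp add: H_def)
      obtain y where "y \<in> Q" "y \<notin> H" "y \<in> normalizer G H"
        using p_subgroup_normalizer_grows[OF fin prime_p Q(1) _ sH H(2)] Q(2) cP by auto
      then show False using inT[OF Q(1,2)] \<open>T = P\<close> by (auto simp: H_def)
    qed
  qed
  \<comment> \<open>If \<open>u \<noteq> \<one>\<close>, then \<open>g u g^-1\<close> is a
    nontrivial common element of \<open>P\<close> and its conjugate by \<open>g\<close>; by
    \<open>TI\<close> the two coincide, and \<open>g\<close> would normalize
    \<open>P\<close>.\<close>
  have free: "u = \<one>" if g: "g \<in> carrier G - M" and u: "u \<in> P" "g \<otimes> u \<otimes> inv g \<in> P" for g u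
  proof (rule ccontr)
    assume "u \<noteq> \<one>"
    have gu: "g \<in> carrier G" "u \<in> carrier G" using g u subP by auto
    have "g \<otimes> u \<otimes> inv g \<noteq> \<one>"
    proof
      assume "g \<otimes> u \<otimes> inv g = \<one>"
      then have "inv g \<otimes> (g \<otimes> u \<otimes> inv g) \<otimes> g = inv g \<otimes> \<one> \<otimes> g" by simp
      then show False using gu \<open>u \<noteq> \<one>\<close> by (simp add: m_assoc)
    qed
    moreover have "g \<otimes> u \<otimes> inv g \<in> P \<inter> conj_set G g P" using u by (auto simp: conj_set_def)
    ultimately have "P \<inter> conj_set G g P \<noteq> {\<one>}" by auto
    moreover have "sylow_subgroup G p (carrier G) (conj_set G g P)"
      using P gu subP by (simp add: sylow_subgroup_def subgroup_conj_set card_conj_set conj_set_subset)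
    ultimately have "conj_set G g P = P" using TI by blast
    then show False using g subP by (simp add: M_def normalizer_eq)
  qed
  interpret GP: group "G\<lparr>carrier := P\<rparr>" using subgroup_imp_group[OF sP] .
  define D where "D = derived G P"
  have D_eq: "derived (G\<lparr>carrier := P\<rparr>) (carrier (G\<lparr>carrier := P\<rparr>)) = D"
    using derived_consistent[OF _ sP] by (simp add: D_def)
  interpret D: normal D "G\<lparr>carrier := P\<rparr>" using GP.derived_self_is_normal unfolding D_eq .
  define A where "A = (G\<lparr>carrier := P\<rparr>) Mod D"
  interpret A: comm_group A using GP.derived_quot_is_comm_group unfolding D_eq A_def .
  define \<phi> where "\<phi> = (\<lambda>u. D #> u)"
  have hom: "\<phi> \<in> hom (G\<lparr>carrier := P\<rparr>) A"
    using D.r_coset_hom_Mod by (simp add: A_def \<phi>_def)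
  have phi_closed: "\<phi> u \<in> carrier A" if "u \<in> P" for u using hom that by (auto simp: hom_def)
  have phi_mult: "\<phi> (u \<otimes> v) = \<phi> u \<otimes>\<^bsub>A\<^esub> \<phi> v" if "u \<in> P" "v \<in> P" for u v
    using hom that by (auto simp: hom_def)
  have conj_closed: "g \<otimes> u \<otimes> inv g \<in> P" if "g \<in> M" "u \<in> P" for g u
    using normalizer_conj_closed[OF subP] that by (simp add: M_def)
  \<comment> \<open>With \<open>g = t c\<close>, the factor \<open>c\<close> acts trivially on
    \<open>P\<close>, and conjugation by \<open>t \<in> P\<close> becomes trivial in the abelian
    quotient \<open>A\<close>.\<close>
  have phi_conj: "\<phi> (g \<otimes> u \<otimes> inv g) = \<phi> u" if g: "g \<in> M" and u: "u \<in> P" for g u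
  proof -
    obtain t c where tc: "t \<in> P" "c \<in> M" "g = t \<otimes> c" "\<forall>s\<in>P. c \<otimes> s = s \<otimes> c"
      using M_split[OF g] by blast
    have cc: "c \<in> carrier G" "t \<in> carrier G" "u \<in> carrier G" using tc subM subP u by auto
    have "c \<otimes> u = u \<otimes> c" using tc(4) u by simp
    then have "c \<otimes> u \<otimes> inv c = u" using cc by (simp add: m_assoc)
    then have "t \<otimes> (c \<otimes> u \<otimes> inv c) \<otimes> inv t = t \<otimes> u \<otimes> inv t" by simp
    then have "g \<otimes> u \<otimes> inv g = t \<otimes> u \<otimes> inv t"
      using cc tc(3) by (simp add: m_assoc inv_mult_group)
    moreover have tut: "t \<otimes> u \<otimes> inv t \<in> P" using conj_closed[of t u] tc(1) u M(2) by auto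
    moreover have "\<phi> (t \<otimes> u \<otimes> inv t) \<otimes>\<^bsub>A\<^esub> \<phi> t = \<phi> u \<otimes>\<^bsub>A\<^esub> \<phi> t"
    proof -
      have "\<phi> (t \<otimes> u \<otimes> inv t) \<otimes>\<^bsub>A\<^esub> \<phi> t = \<phi> (t \<otimes> u \<otimes> inv t \<otimes> t)"
        using phi_mult[OF tut tc(1)] by simp
      also have "t \<otimes> u \<otimes> inv t \<otimes> t = t \<otimes> u" using cc by (simp add: m_assoc)
      also have "\<phi> (t \<otimes> u) = \<phi> u \<otimes>\<^bsub>A\<^esub> \<phi> t"
        using phi_mult[OF tc(1) u] A.m_comm[OF phi_closed[OF tc(1)] phi_closed[OF u]] by simp
      finally show ?thesis .
    qed
    ultimately show ?thesis using phi_closed tc(1) u by simp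
  qed
  have "\<exists>V \<in> hom G A. \<forall>x\<in>P. V x = \<phi> x [^]\<^bsub>A\<^esub> (card M div card P)"
    by (rule transfer_to_abelian_group[OF is_group fin sP M A.comm_group_axioms hom])
      (fact free conj_closed phi_conj)+
  then obtain V where V: "V \<in> hom G A" "\<And>x. x \<in> P \<Longrightarrow> V x = \<phi> x [^]\<^bsub>A\<^esub> (card M div card P)"
    by blast
  \<comment> \<open>A nontrivial solvable group is not perfect, so some \<open>x \<in> P\<close> has
    nontrivial image in \<open>A\<close>.\<close>
  have "D \<noteq> P"
  proof
    assume "D = P"
    then have "(derived G ^^ n) P = P" for n by (induction n) (simp_all add: D_def)
    moreover have "solvable_seq G P" using p_subgroup_solvable[OF fin prime_p sP cP] .
    ultimately show False using solvable_imp_trivial_derived_seq Pnt by metis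
  qed
  then obtain x where x: "x \<in> P" "x \<notin> D" using D.subset by auto
  have Vx: "V x \<noteq> \<one>\<^bsub>A\<^esub>"
  proof
    define n where "n = card M div card P"
    assume "V x = \<one>\<^bsub>A\<^esub>"
    then have n: "\<phi> x [^]\<^bsub>A\<^esub> n = \<one>\<^bsub>A\<^esub>" using V(2)[OF x(1)] by (simp add: n_def)
    have cM: "card M = p ^ multiplicity p (card M) * n"
      using PsylM card_subgroup_dvd[OF sP M] by (simp add: n_def sylow_subgroup_def)
    have "\<not> p dvd n"
    proof
      assume "p dvd n"
      then have "p ^ Suc (multiplicity p (card M)) dvd card M"
        by (subst cM) (simp add: mult.commute mult_dvd_mono)
      then show False
        using card_subgroup_pos[OF fin M(1)] prime_p
        by (metis multiplicity_dvd_iff_dvd not_less_eq_eq le_refl power_dvd_iff_le_multiplicity not_gr_zero not_prime_unit)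
    qed
    then have "coprime (card P) n" using prime_p cP by (simp add: prime_imp_coprime_nat)
    moreover have "card P = order A * card D"
      using GP.lagrange[OF D.is_subgroup] by (simp add: A_def order_def FactGroup_def)
    ultimately have "coprime n (order A)" by (simp add: ac_simps)
    moreover have "n \<noteq> 0" using \<open>\<not> p dvd n\<close> by (metis dvd_0_right)
    \<comment> \<open>As the index of a Sylow subgroup of \<open>M\<close>, \<open>n\<close> is
      prime to \<open>order A\<close>. Bezout coefficients thus write \<open>\<phi> x\<close> as a
      power of its \<open>n\<close>-th power, which is trivial.\<close>
    ultimately obtain i j where ij: "n * i = order A * j + 1"
      using bezout_nat[of n "order A"] by auto
    have finA: "finite (carrier A)"
      using finite_subset[OF subP fin] by (simp add: A_def FactGroup_def RCOSETS_def)
    have px: "\<phi> x \<in> carrier A" using phi_closed x(1) by simp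
    have "\<phi> x [^]\<^bsub>A\<^esub> (order A * j) = \<one>\<^bsub>A\<^esub>"
      using A.power_order_eq_one[OF finA px] A.nat_pow_pow[OF px, of "order A" j]
      by (simp add: order_def)
    then have "\<phi> x = \<phi> x [^]\<^bsub>A\<^esub> (order A * j + 1)"
      using px by simp
    also have "\<dots> = (\<phi> x [^]\<^bsub>A\<^esub> n) [^]\<^bsub>A\<^esub> i"
      unfolding ij[symmetric] using px by (simp add: A.nat_pow_pow)
    also have "\<dots> = \<one>\<^bsub>A\<^esub>" using n by simp
    finally have "D #> x = D" by (simp add: \<phi>_def A_def FactGroup_def)
    moreover have "x \<in> D #> x" using GP.rcos_self[of x D] D.is_subgroup x(1) by simp
    ultimately show False using x(2) by simp
  qed
  interpret V: group_hom G A V using V(1) by unfold_locales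
  have nK: "kernel G A V \<lhd> G" by (rule V.normal_kernel)
  \<comment> \<open>By minimality the intersection is trivial or \<open>L\<close>, and
    \<open>x \<in> P \<subseteq> L\<close> is not in the kernel. So \<open>V\<close> embeds
    \<open>L\<close> into the abelian group \<open>A\<close>.\<close>
  have "L \<inter> kernel G A V = {\<one>}"
  proof (rule ccontr)
    assume "L \<inter> kernel G A V \<noteq> {\<one>}"
    then have "L \<inter> kernel G A V = L"
      using L_min[OF normal_subgroup_intersect[OF L_normal nK]] by blast
    then have "x \<in> kernel G A V" using x(1) PsL by auto
    then show False using Vx by (simp add: kernel_def)
  qed
  then have comm: "a \<otimes> b = b \<otimes> a" if "a \<in> L" "b \<in> L" for a b
  proof -
    have ab: "a \<in> carrier G" "b \<in> carrier G" using that by auto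
    have "V a \<otimes>\<^bsub>A\<^esub> V b = V b \<otimes>\<^bsub>A\<^esub> V a" using ab by (simp add: A.m_comm)
    then have "V (a \<otimes> b \<otimes> inv a \<otimes> inv b) = \<one>\<^bsub>A\<^esub>"
      using ab by (simp add: A.m_assoc)
    then have "a \<otimes> b \<otimes> inv a \<otimes> inv b \<in> L \<inter> kernel G A V"
      using that ab by (simp add: kernel_def)
    then have "a \<otimes> b \<otimes> inv a \<otimes> inv b = \<one>" using \<open>L \<inter> kernel G A V = {\<one>}\<close> by simp
    then have "a \<otimes> b \<otimes> inv a \<otimes> inv b \<otimes> b \<otimes> a = b \<otimes> a" using ab by simp
    then show ?thesis using ab by (simp add: m_assoc)
  qed
  \<comment> \<open>An abelian \<open>L\<close> containing \<open>P\<close> centralizes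
    \<open>P\<close>; then \<open>G = L M\<close> collapses to \<open>M\<close>.\<close>
  have "L \<subseteq> M"
  proof
    fix l assume l: "l \<in> L"
    have "l \<otimes> s \<otimes> inv l \<in> P" if "s \<in> P" for s
    proof -
      have "l \<otimes> s = s \<otimes> l" "s \<in> carrier G" using comm[of l s] l that PsL subP by auto
      then show ?thesis using that l by (simp add: m_assoc)
    qed
    then show "l \<in> M" using mem_normalizerI[OF fin subP] l by (simp add: M_def)
  qed
  then have "L <#> M \<subseteq> M" using subgroup.m_closed[OF M(1)] by (auto simp: set_mult_def)
  then show False using LMG Mne subM by blast
qed

end

section \<open>Induction over quotients\<close>

text \<open>Keeps the prime as an argument, because a quotient may have to be treated with a
  different prime.\<close>

definition max_condition :: "nat \<Rightarrow> ('a, 'b) monoid_scheme \<Rightarrow> bool" where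
  "max_condition p G \<longleftrightarrow> (\<forall>H. maximal_subgroup H G \<longrightarrow>
     nilpotent_group (G\<lparr>carrier := H\<rparr>) \<or> H \<lhd> G \<or> \<not> p dvd card H)"

context group_hom
begin

lemma card_img_dvd:
  assumes "subgroup X G"
  shows "card (h ` X) dvd card X"
proof -
  interpret X: group_hom "G\<lparr>carrier := X\<rparr>" "H\<lparr>carrier := h ` X\<rparr>" h
    using induced_group_hom[OF assms] .
  have "order ((G\<lparr>carrier := X\<rparr>) Mod kernel (G\<lparr>carrier := X\<rparr>) (H\<lparr>carrier := h ` X\<rparr>) h) = card (h ` X)"
    using iso_same_order[OF X.FactGroup_iso_set] by (simp add: order_def)
  then show ?thesis
    using X.G.lagrange[OF X.subgroup_kernel] by (simp add: order_def FactGroup_def) (metis dvd_triv_left)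
qed

text \<open>The preimage \<open>X\<close> of a maximal subgroup is maximal and contains the kernel.
  If \<open>p\<close> divides the order of the kernel, it divides \<open>card X\<close>, so the
  alternative on orders never arises and \<open>r\<close> is arbitrary. For \<open>r = p\<close>
  that alternative passes to the image, whose order divides \<open>card X\<close>.\<close>

lemma max_condition_img:
  assumes surj: "h ` carrier G = carrier H" and fin: "finite (carrier G)"
    and G: "max_condition p G" and r: "r = p \<or> p dvd card (kernel G H h)"
  shows "max_condition r H"
  unfolding max_condition_def
proof (intro allI impI)
  fix M assume M: "maximal_subgroup M H"
  then have sM: "subgroup M H" and Mne: "M \<noteq> carrier H" by (auto simp: maximal_subgroup_def)
  interpret M: subgroup M H by fact
  define X where "X = {x \<in> carrier G. h x \<in> M}"
  have X: "subgroup X G" by (rule G.subgroupI) (auto simp: X_def intro!: exI[of _ "\<one>"])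
  have img: "h ` X = M"
  proof
    show "M \<subseteq> h ` X"
    proof
      fix y assume "y \<in> M"
      then have "y \<in> h ` carrier G" using M.subset surj by auto
      then show "y \<in> h ` X" using \<open>y \<in> M\<close> by (auto simp: X_def)
    qed
  qed (auto simp: X_def)
  have ker: "kernel G H h \<subseteq> X" by (auto simp: kernel_def X_def)
  have "maximal_subgroup X G"
    unfolding maximal_subgroup_def
  proof (intro conjI allI impI)
    show "subgroup X G" by (rule X)
    show "X \<noteq> carrier G" using img surj Mne by auto
    fix K assume "subgroup K G \<and> X \<subseteq> K"
    then have K: "subgroup K G" "X \<subseteq> K" by auto
    then have "subgroup (h ` K) H" "M \<subseteq> h ` K"
      using subgroup_img_is_subgroup[OF K(1)] img by auto
    then consider "h ` K = M" | "h ` K = carrier H"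
      using M unfolding maximal_subgroup_def by blast
    then show "K = X \<or> K = carrier G"
    proof cases
      case 1
      then have "K \<subseteq> X" using subgroup.subset[OF K(1)] by (auto simp: X_def)
      then show ?thesis using K by auto
    next
      case 2
      have "x \<in> K" if x: "x \<in> carrier G" for x
      proof -
        have "h x \<in> h ` K" using 2 x by auto
        then obtain k where k: "k \<in> K" "h x = h k" by auto
        then have kc: "k \<in> carrier G" using subgroup.subset[OF K(1)] by auto
        have "x \<otimes> inv k \<in> kernel G H h" using x kc k(2) by (simp add: kernel_def)
        then have "x \<otimes> inv k \<in> K" using ker K(2) by blast
        then have "x \<otimes> inv k \<otimes> k \<in> K" using subgroup.m_closed[OF K(1)] k(1) by blast
        then show ?thesis using x kc by (simp add: G.m_assoc)
      qed
      then show ?thesis using subgroup.subset[OF K(1)] by auto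
    qed
  qed
  then consider "nilpotent_group (G\<lparr>carrier := X\<rparr>)" | "X \<lhd> G" | "\<not> p dvd card X"
    using G unfolding max_condition_def by blast
  then show "nilpotent_group (H\<lparr>carrier := M\<rparr>) \<or> M \<lhd> H \<or> \<not> r dvd card M"
  proof cases
    case 1
    then show ?thesis using nilpotent_img[OF X] img by simp
  next
    case 2
    then show ?thesis
      using normal.surj_hom_normal_subgroup[OF 2 group_hom_axioms surj] img by simp
  next
    case 3
    have "\<not> p dvd card (kernel G H h)"
      using 3 G.card_subgroup_dvd[OF subgroup_kernel X ker] dvd_trans by blast
    then have "r = p" using r by blast
    then show ?thesis using 3 card_img_dvd[OF X] img dvd_trans by auto
  qed
qed

end

section \<open>Minimal normal subgroups, quotients and the induction on the order\<close>

lemma (in group) minimal_normal_exists: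
  assumes fin: "finite (carrier G)" and nt: "carrier G \<noteq> {\<one>}"
  shows "\<exists>L. L \<lhd> G \<and> L \<noteq> {\<one>} \<and> (\<forall>N. N \<lhd> G \<longrightarrow> N \<subseteq> L \<longrightarrow> N \<noteq> {\<one>} \<longrightarrow> N = L)"
proof -
  define F where "F = {N. N \<lhd> G \<and> N \<noteq> {\<one>}}"
  have "finite F"
    using fin normal_imp_subgroup subgroup.subset
    by (intro finite_subset[of F "Pow (carrier G)"]) (fastforce simp: F_def)+
  moreover have "carrier G \<in> F" using nt normal_self by (simp add: F_def)
  ultimately obtain L where "L \<in> F" "\<And>N. N \<in> F \<Longrightarrow> N \<subseteq> L \<Longrightarrow> L = N"
    using finite_has_minimal[of F] by blast
  then show ?thesis by (intro exI[of _ L]) (auto simp: F_def)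
qed

text \<open>The quotient \<open>G / N\<close> is realised on coset representatives, hence on the type of \<open>G\<close>;
  this is what allows an induction over quotients.\<close>

lemma (in group) quotient_on_same_type:
  fixes N
  assumes N: "N \<lhd> G"
  shows "\<exists>(H :: 'a monoid) h. group_hom G H h \<and> h ` carrier G = carrier H \<and> kernel G H h = N"
proof -
  interpret N: normal N G by fact
  define f where "f x = (SOME c. c \<in> N #> x)" for x
  have f: "f x \<in> N #> x" if "x \<in> carrier G" for x
    unfolding f_def using rcos_self[OF that N.is_subgroup] by (rule someI)
  have wm: "weak_group_morphism f N G"
  proof (rule weak_group_morphismsI[OF N])
    fix a b assume ab: "a \<in> carrier G" "b \<in> carrier G"
    show "f a = f b \<longleftrightarrow> a \<otimes> inv b \<in> N"
    proof
      assume "f a = f b"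
      then have "N #> a = N #> b"
        using repr_independence[OF f[OF ab(1)] ab(1) N.is_subgroup]
          repr_independence[OF f[OF ab(2)] ab(2) N.is_subgroup] by simp
      then show "a \<otimes> inv b \<in> N"
        using rcos_self[OF ab(1) N.is_subgroup] N.rcos_module_imp[OF is_group ab(2), of a] by simp
    next
      assume "a \<otimes> inv b \<in> N"
      then have "a \<in> N #> b" using N.rcos_module_rev[OF is_group ab(2,1)] by simp
      then have "N #> b = N #> a" using repr_independence ab N.is_subgroup by blast
      then show "f a = f b" by (simp add: f_def)
    qed
  qed
  show ?thesis
    using weak_group_morphism_group_hom[OF wm] weak_group_morphism_ker[OF wm]
    by (intro exI[of _ "image_group f G"] exI[of _ f]) (simp add: image_group_carrier)
qed

text \<open>Kept apart from the induction so that \<open>G\<close> may belong to any record scheme,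
  while \<open>IH\<close> concerns plain monoids over the same element type, where the quotients are
  realised. The prime \<open>r\<close> varies because \<open>p\<close> may not divide the order of a
  quotient.\<close>

lemma solvable_induction_step:
  fixes G :: "('a, 'b) monoid_scheme" (structure)
  assumes "group G" and fin: "finite (carrier G)" and p: "prime p" "p dvd order G"
    and cond: "max_condition p G"
    and IH: "\<And>(H :: 'a monoid) r. group H \<Longrightarrow> finite (carrier H) \<Longrightarrow> prime r \<Longrightarrow> r dvd order H \<Longrightarrow>
      max_condition r H \<Longrightarrow> order H < order G \<Longrightarrow> solvable H"
  shows "solvable G"
proof -
  interpret group G by fact
  have posG: "0 < order G" using fin order_gt_0_iff_finite by simp
  have by_quotient: "solvable G"
    if N: "N \<lhd> G" "N \<noteq> {\<one>}" "solvable_seq G N" and idx: "p dvd card N \<or> p dvd order G div card N" for N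
  proof -
    obtain H :: "'a monoid" and h where h: "group_hom G H h" "h ` carrier G = carrier H" "kernel G H h = N"
      using quotient_on_same_type[OF N(1)] by blast
    interpret h: group_hom G H h by fact
    have finH: "finite (carrier H)" using h(2) fin by (metis finite_imageI)
    have sN: "subgroup N G" using N(1) by (rule normal_imp_subgroup)
    have posN: "0 < card N" using card_subgroup_pos[OF fin sN] .
    have "order H = card (rcosets N)"
      using iso_same_order[OF h.FactGroup_iso_set[OF h(2)]] h(3) by (simp add: order_def FactGroup_def)
    then have ord: "order H * card N = order G" using lagrange[OF sN] by simp
    then have ordH: "order H = order G div card N" using posN by (metis nonzero_mult_div_cancel_right less_not_refl)
    have "card N \<noteq> 1" using N(2) subgroup.one_closed[OF sN] by (metis card_1_singletonE singletonD)
    then have less: "order H < order G"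
      using posN posG ord by (metis One_nat_def Suc_lessI mult_0 n_less_m_mult_n neq0_conv mult.commute)
    have "solvable H"
    proof (cases "p dvd order H")
      case True
      then show ?thesis
        using IH[OF h.H.is_group finH p(1) True h.max_condition_img[OF h(2) fin cond] less] by simp
    next
      case False
      \<comment> \<open>Here \<open>p\<close> divides the order of the kernel, so the quotient
        satisfies \<open>max_condition\<close> for any prime divisor \<open>r\<close> of its
        order.\<close>
      then have pN: "p dvd card N" using idx ordH by simp
      show ?thesis
      proof (cases "order H = 1")
        case True
        then have "carrier H = {\<one>\<^bsub>H\<^esub>}" using h.H.order_one_triv_iff by blast
        then show ?thesis using solvable_seq.unity[of H] by (simp add: solvable_def)
      next
        case False
        then obtain r where r: "prime r" "r dvd order H" using prime_factor_nat by blast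
        show ?thesis
          using IH[OF h.H.is_group finH r h.max_condition_img[OF h(2) fin cond] less] pN h(3) by simp
      qed
    qed
    \<comment> \<open>The extension criterion takes two homomorphisms in sequence; the identity of
      \<open>G\<close>, applied to the solvable \<open>N\<close>, covers the kernel of
      \<open>h\<close>.\<close>
    moreover have "group_hom G G (\<lambda>x. x)"
      using is_group by (auto simp: group_hom_def group_hom_axioms_def hom_def)
    ultimately show ?thesis
      using solvable_seq_condition[of G G "\<lambda>x. x" H h N "carrier G"] h N(3) subgroup_self
        subgroup.subset[OF sN] by (simp add: solvable_def)
  qed
  show ?thesis
  proof (cases "\<exists>R a. R \<lhd> G \<and> card R = p ^ a \<and> R \<noteq> {\<one>}")
    case True
    then obtain R a where R: "R \<lhd> G" "card R = p ^ a" "R \<noteq> {\<one>}" by blast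
    have sR: "subgroup R G" using R(1) by (rule normal_imp_subgroup)
    have "a \<noteq> 0"
    proof
      assume "a = 0"
      then show False using R(2,3) subgroup.one_closed[OF sR] by (auto simp: card_1_singleton_iff)
    qed
    then have "p dvd card R" using R(2) by (simp add: dvd_power)
    then show ?thesis using by_quotient[OF R(1,3)] p_subgroup_solvable[OF fin p(1) sR R(2)] by blast
  next
    case False
    have "carrier G \<noteq> {\<one>}" using p by (auto simp: order_def)
    then obtain L where L: "L \<lhd> G" "L \<noteq> {\<one>}"
      "\<And>N. N \<lhd> G \<Longrightarrow> N \<subseteq> L \<Longrightarrow> N \<noteq> {\<one>} \<Longrightarrow> N = L"
      using minimal_normal_exists[OF fin] by blast
    interpret minimal_normal_no_p_core G p L
    proof (rule minimal_normal_no_p_core.intro[OF is_group], rule minimal_normal_no_p_core_axioms.intro)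
      show "nilpotent_group (G\<lparr>carrier := H\<rparr>) \<or> H \<lhd> G"
        if "maximal_subgroup H G" "p dvd card H" for H
        using cond that by (auto simp: max_condition_def)
      show "R = {\<one>}" if "R \<lhd> G" "card R = p ^ a" for R a
        using False that by blast
    qed (fact fin p L)+
    obtain q a where q: "prime q" "card L = q ^ a"
      using prime_power_if_p_dvd_index[OF p_dvd_index] by blast
    have "solvable_seq G L"
      using p_subgroup_solvable[OF fin q(1) normal_imp_subgroup[OF L(1)] q(2)] .
    then show ?thesis using by_quotient[OF L(1,2)] p_dvd_index by blast
  qed
qed

text \<open>Stated for plain monoids, since the induction must range over groups of one fixed type;
  \<open>quotient_on_same_type\<close> stays within it.\<close>

lemma solvable_if_max_condition:
  fixes G :: "'a monoid"
  assumes "group G" "finite (carrier G)" "prime p" "p dvd order G" "max_condition p G"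
  shows "solvable G"
  using assms
proof (induction "order G" arbitrary: G p rule: less_induct)
  case less
  show ?case
    by (rule solvable_induction_step[OF less.prems]) (rule less.hyps)
qed

theorem theorem1p3:
  fixes G (structure) and p :: nat
  assumes "group G"
    and "finite (carrier G)"
    and "prime p"
    and "p dvd order G"
    and "\<forall>H. maximal_subgroup H G \<longrightarrow>
           nilpotent_group (G\<lparr>carrier := H\<rparr>) \<or> H \<lhd> G \<or> \<not> p dvd card H"
  shows "solvable G"
proof -
  have "max_condition p G" using assms(5) by (simp add: max_condition_def)
  \<comment> \<open>A group in an arbitrary record scheme is reached by one further induction step,
    whose quotients are plain monoids.\<close>
  from solvable_induction_step[OF assms(1-4) this solvable_if_max_condition] show ?thesis .
qed

end
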